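(* There exist positive constants $c_1, c_2$ such that for all $n\geq 2$, $$c_1 n^5/\log n \leq AR_s(K_n) \leq c_2 n^6/\log^2 n.$$
   Context: All graphs are finite and simple; $K_n$ is the complete graph on $n$ vertices. An edge-coloring is proper if adjacent edges receive distinct colors; an edge-colored graph is rainbow if all its edges have distinct colors. A copy of $H$ is a (not necessarily induced) subgraph isomorphic to $H$. $AR_s(H)$ is the smallest number of edges in a graph $G$ such that every proper edge-coloring of $G$ contains a rainbow copy of $H$. *)

theory Defs
  imports Complex_Main "HOL-Library.Ramsey"
begin

(* A graph is a pair (V, E); an undirected edge is the two-element set of its endpoints. *)
type_synonym 'a graph = "'a set \<times> 'a set set"

abbreviation verts :: "'a graph \<Rightarrow> 'a set" where
  "verts G \<equiv> fst G"

abbreviation edges :: "'a graph \<Rightarrow> 'a set set" where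
  "edges G \<equiv> snd G"

definition finite_simple_graph :: "'a graph \<Rightarrow> bool" where
  "finite_simple_graph G \<longleftrightarrow> finite (verts G) \<and> edges G \<subseteq> [verts G]\<^bsup>2\<^esup>"

definition complete_graph :: "nat \<Rightarrow> nat graph" where
  "complete_graph n = ({..<n}, [{..<n}]\<^bsup>2\<^esup>)"

definition is_subgraph :: "'a graph \<Rightarrow> 'a graph \<Rightarrow> bool" where
  "is_subgraph F G \<longleftrightarrow>
     finite_simple_graph F \<and> verts F \<subseteq> verts G \<and> edges F \<subseteq> edges G"

definition isomorphic :: "'a graph \<Rightarrow> 'b graph \<Rightarrow> bool" where
  "isomorphic G H \<longleftrightarrow>
     (\<exists>f. bij_betw f (verts G) (verts H) \<and>
          (\<forall>u\<in>verts G. \<forall>v\<in>verts G. {u, v} \<in> edges G \<longleftrightarrow> {f u, f v} \<in> edges H))"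

definition is_copy :: "'a graph \<Rightarrow> 'b graph \<Rightarrow> 'a graph \<Rightarrow> bool" where
  "is_copy F H G \<longleftrightarrow> is_subgraph F G \<and> isomorphic F H"

(* Colors are natural numbers: a finite graph uses only finitely many colors.
   The values of an edge-coloring outside the edge set are irrelevant. *)
definition proper_edge_coloring :: "'a graph \<Rightarrow> ('a set \<Rightarrow> nat) \<Rightarrow> bool" where
  "proper_edge_coloring G c \<longleftrightarrow>
     (\<forall>e\<in>edges G. \<forall>e'\<in>edges G. e \<noteq> e' \<and> e \<inter> e' \<noteq> {} \<longrightarrow> c e \<noteq> c e')"

definition rainbow :: "'a graph \<Rightarrow> ('a set \<Rightarrow> nat) \<Rightarrow> bool" where
  "rainbow F c \<longleftrightarrow> inj_on c (edges F)"

definition forces_rainbow :: "'a graph \<Rightarrow> 'b graph \<Rightarrow> bool" where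
  "forces_rainbow G H \<longleftrightarrow>
     (\<forall>c. proper_edge_coloring G c \<longrightarrow> (\<exists>F. is_copy F H G \<and> rainbow F c))"

(* Every finite graph is isomorphic to one with vertices in nat, so it suffices that
   G ranges over such graphs.  LEAST presupposes that some G forces a rainbow copy of H,
   which is the case for every finite simple H. *)
definition AR\<^sub>s :: "'b graph \<Rightarrow> nat" where
  "AR\<^sub>s H = (LEAST m. \<exists>G :: nat graph.
     finite_simple_graph G \<and> card (edges G) = m \<and> forces_rainbow G H)"

end

theory Submission
  imports Defs
begin

text \<open>
  Upper bound: every proper coloring of \<open>K\<^sub>N\<close> with \<open>N = s\<^sup>3\<^sup>5\<close> has a rainbow clique of size about
  \<open>(N log N)\<^sup>1\<^sup>/\<^sup>3\<close>. Call a 4-set a clash if it splits into two edges of the same color; by properness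
  every triple lies in at most three clashes, and rainbow cliques are the clash-free sets. Take a random
  \<open>m\<close>-set \<open>X\<close> of vertices, with \<open>m\<close> slightly larger than \<open>N\<^sup>1\<^sup>/\<^sup>3\<close>, and a uniformly random clash-free
  subset \<open>I\<close> of \<open>X\<close>. For most \<open>v \<in> X\<close> the clashes within \<open>X\<close> look like a linear triangle-free hypergraph
  around \<open>v\<close>, so either \<open>v \<in> I\<close> has probability at least about \<open>1/w\<close>, or \<open>I\<close> contains on average
  at least about \<open>log w\<close> of the triples that form a clash with \<open>v\<close>. Averaged over \<open>X\<close> and \<open>v\<close>, the first quantity is
  at most \<open>|I|/m\<close> and the second is of order \<open>|I|\<^sup>3/N\<close>, which forces \<open>|I|\<^sup>3 \<ge> c N log w\<close>.

  Lower bound: in a graph with few edges, only \<open>O(n\<^sup>3/log n)\<close> vertices have degree of order \<open>n\<^sup>2\<close>. The edges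
  between vertices of low degree are colored greedily with too few colors for a rainbow \<open>K\<^bsub>n/2\<^esub>\<close>. The edges
  between vertices of high degree get independent random colors; in each color a maximal matching is
  kept, and all other edges receive private colors. For disjoint vertex sets \<open>A\<close>, \<open>B\<close> of size \<open>a\<close> and fixed colors
  outside \<open>A\<close> and \<open>B\<close>, it is unlikely that no color occurs both inside \<open>A\<close> and inside \<open>B\<close> on edges whose
  outside neighbors avoid this color; the union bound over \<open>A\<close>, \<open>B\<close> then excludes a rainbow \<open>K\<^bsub>2a\<^esub>\<close>.
\<close>

section \<open>Copies of complete graphs\<close>

text \<open>A bijection onto the vertices of a complete graph carries every pair to an edge, so a
  copy has all pairs on its vertex set as edges; conversely, any enumeration of a clique is an
  isomorphism.\<close>

lemma copy_complete_iff:
  "is_copy F (complete_graph n) G \<longleftrightarrow>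
    (\<exists>K. K \<subseteq> verts G \<and> finite K \<and> card K = n \<and> [K]\<^bsup>2\<^esup> \<subseteq> edges G \<and> F = (K, [K]\<^bsup>2\<^esup>))"
proof
  assume "is_copy F (complete_graph n) G"
  then obtain f where F: "finite (verts F)" "edges F \<subseteq> [verts F]\<^bsup>2\<^esup>" "verts F \<subseteq> verts G" "edges F \<subseteq> edges G"
    and f: "bij_betw f (verts F) {..<n}"
    and e: "\<And>u v. u \<in> verts F \<Longrightarrow> v \<in> verts F \<Longrightarrow> {u, v} \<in> edges F \<longleftrightarrow> {f u, f v} \<in> [{..<n}]\<^bsup>2\<^esup>"
    by (auto simp: is_copy_def is_subgraph_def finite_simple_graph_def isomorphic_def complete_graph_def)
  have "[verts F]\<^bsup>2\<^esup> \<subseteq> edges F"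
  proof
    fix q assume "q \<in> [verts F]\<^bsup>2\<^esup>"
    then obtain u v where q: "q = {u, v}" "u \<in> verts F" "v \<in> verts F" "u \<noteq> v"
      by (auto simp: nsets_def card_2_iff)
    have "f u \<noteq> f v" "f u < n" "f v < n"
      using f q by (auto simp: bij_betw_def inj_on_def)
    then show "q \<in> edges F" using q e by (auto simp: nsets_def)
  qed
  then have "edges F = [verts F]\<^bsup>2\<^esup>" using F by blast
  then show "\<exists>K. K \<subseteq> verts G \<and> finite K \<and> card K = n \<and> [K]\<^bsup>2\<^esup> \<subseteq> edges G \<and> F = (K, [K]\<^bsup>2\<^esup>)"
    using F bij_betw_same_card[OF f] by (intro exI[of _ "verts F"]) (auto simp: prod_eq_iff)
next
  assume "\<exists>K. K \<subseteq> verts G \<and> finite K \<and> card K = n \<and> [K]\<^bsup>2\<^esup> \<subseteq> edges G \<and> F = (K, [K]\<^bsup>2\<^esup>)"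
  then obtain K where K: "K \<subseteq> verts G" "finite K" "card K = n" "[K]\<^bsup>2\<^esup> \<subseteq> edges G" "F = (K, [K]\<^bsup>2\<^esup>)"
    by blast
  obtain f where f: "bij_betw f K {..<n}"
    using K finite_same_card_bij[of K "{..<n}"] by auto
  \<comment> \<open>The case \<open>u = v\<close> is part of \<open>isomorphic\<close>; singletons
    are edges on neither side, which uses injectivity of \<open>f\<close>.\<close>
  have "{u, v} \<in> [K]\<^bsup>2\<^esup> \<longleftrightarrow> {f u, f v} \<in> [{..<n}]\<^bsup>2\<^esup>" if "u \<in> K" "v \<in> K" for u v
  proof -
    have "f u < n" "f v < n" "f u = f v \<longleftrightarrow> u = v"
      using f that by (auto simp: bij_betw_def inj_on_def)
    then show ?thesis using that by (cases "u = v") (auto simp: nsets_def)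
  qed
  then have "isomorphic F (complete_graph n)"
    unfolding isomorphic_def complete_graph_def using f K(5) by auto
  then show "is_copy F (complete_graph n) G"
    using K by (simp add: is_copy_def is_subgraph_def finite_simple_graph_def)
qed

lemma forces_rainbow_complete_iff:
  "forces_rainbow G (complete_graph n) \<longleftrightarrow>
    (\<forall>c. proper_edge_coloring G c \<longrightarrow>
      (\<exists>K. K \<subseteq> verts G \<and> finite K \<and> card K = n \<and> [K]\<^bsup>2\<^esup> \<subseteq> edges G \<and> inj_on c ([K]\<^bsup>2\<^esup>)))"
  unfolding forces_rainbow_def copy_complete_iff rainbow_def by (metis snd_conv)

section \<open>Four-uniform hypergraphs with bounded triple degree\<close>

definition edge_free :: "'a set set \<Rightarrow> 'a set \<Rightarrow> bool" where
  "edge_free H I \<longleftrightarrow> (\<forall>q\<in>H. \<not> q \<subseteq> I)"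

lemma edge_free_subset: "edge_free H I \<Longrightarrow> J \<subseteq> I \<Longrightarrow> edge_free H J"
  unfolding edge_free_def by blast

text \<open>With N = \<open>card V\<close>, a uniformly random \<open>m\<close>-set contains
  \<open>U\<close> with probability the product of (m - i)/(N - i) over i < \<open>card U\<close>,
  and each factor is at most m/N because m \<le> N.\<close>

lemma card_supersets_le:
  assumes "finite V" "U \<subseteq> V" "m \<le> card V" "card V > 0"
  shows "real (card {X \<in> [V]\<^bsup>m\<^esup>. U \<subseteq> X})
    \<le> (real m / real (card V)) ^ card U * real (card V choose m)"
proof (cases "card U \<le> m")
  case False
  have "{X \<in> [V]\<^bsup>m\<^esup>. U \<subseteq> X} = {}"
    using False card_mono by (auto simp: nsets_def)
  then show ?thesis by (simp only: card.empty) simp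
next
  case True
  have fU: "finite U" using assms finite_subset by blast
  have "bij_betw (\<lambda>Z. Z \<union> U) (nsets (V - U) (m - card U)) {X \<in> [V]\<^bsup>m\<^esup>. U \<subseteq> X}"
  proof (rule bij_betw_byWitness[where f' = "\<lambda>X. X - U"])
    show "(\<lambda>Z. Z \<union> U) ` nsets (V - U) (m - card U) \<subseteq> {X \<in> [V]\<^bsup>m\<^esup>. U \<subseteq> X}"
    proof safe
      fix Z assume "Z \<in> nsets (V - U) (m - card U)"
      then have "Z \<subseteq> V - U" "finite Z" "card Z = m - card U" by (auto simp: nsets_def)
      moreover from this have "card (Z \<union> U) = card Z + card U"
        using fU by (intro card_Un_disjoint) auto
      ultimately show "Z \<union> U \<in> [V]\<^bsup>m\<^esup>"
        using fU True assms(2) by (auto simp: nsets_def)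
    qed
    show "(\<lambda>X. X - U) ` {X \<in> [V]\<^bsup>m\<^esup>. U \<subseteq> X} \<subseteq> nsets (V - U) (m - card U)"
      using fU by (auto simp: nsets_def card_Diff_subset)
  qed (auto simp: nsets_def)
  then have eq: "card {X \<in> [V]\<^bsup>m\<^esup>. U \<subseteq> X} = (card V - card U) choose (m - card U)"
    using assms fU by (simp add: bij_betw_same_card[symmetric] card_nsets card_Diff_subset)
  have "real ((N - s) choose (m - s)) \<le> (real m / real N) ^ s * real (N choose m)"
    if "s \<le> m" "m \<le> N" "N > 0" for s N m :: nat
    using that
  proof (induction s)
    case (Suc s)
    define a b where "a = N - Suc s" and "b = m - Suc s"
    have ab: "N - s = Suc a" "m - s = Suc b" using Suc.prems by (auto simp: a_def b_def)
    have "real (Suc a) * real (a choose b) = real (Suc b) * real (Suc a choose Suc b)"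
      by (metis Suc_times_binomial_eq mult.commute of_nat_mult)
    then have "real (a choose b) = real (Suc b) / real (Suc a) * real (Suc a choose Suc b)"
      by (simp add: field_simps del: of_nat_Suc binomial_Suc_Suc)
    also have "real (Suc b) / real (Suc a) \<le> real m / real N"
    proof -
      have "real (Suc b) = real m - real s" "real (Suc a) = real N - real s" "real s < real N"
        using Suc.prems ab by (auto simp: b_def a_def of_nat_diff)
      then show ?thesis using Suc.prems
        by (simp add: divide_simps) (simp add: algebra_simps mult_right_mono)
    qed
    also have "real m / real N * real (Suc a choose Suc b)
      \<le> real m / real N * ((real m / real N) ^ s * real (N choose m))"
      using Suc.IH Suc.prems ab by (intro mult_left_mono) auto
    finally show ?case
      by (simp add: a_def b_def mult.assoc mult_right_mono)
  qed simp
  from this[OF True assms(3,4)] eq show ?thesis by simp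
qed

locale quadruple_system =
  fixes V :: "'a set" and H :: "'a set set"
  assumes finite_V: "finite V"
    and H_sub: "H \<subseteq> [V]\<^bsup>4\<^esup>"
    and triple_degree: "\<And>Y. Y \<in> [V]\<^bsup>3\<^esup> \<Longrightarrow> card {q \<in> H. Y \<subseteq> q} \<le> 3"
begin

lemma finite_H: "finite H"
  using H_sub finite_V finite_imp_finite_nsets finite_subset by blast

lemma edgeD: "q \<in> H \<Longrightarrow> q \<subseteq> V" "q \<in> H \<Longrightarrow> card q = 4" "q \<in> H \<Longrightarrow> finite q"
  using H_sub by (auto simp: nsets_def)

text \<open>Dropping a vertex from a triple costs a factor of at most \<open>card V\<close>: an edge
  through \<open>Y\<close> has a further vertex \<open>z\<close>, and the edges through
  \<open>insert z Y\<close> are bounded by induction.\<close>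

lemma degree_le:
  assumes "Y \<subseteq> V" "card Y = 3 - j" "j \<le> 3"
  shows "card {q \<in> H. Y \<subseteq> q} \<le> 3 * card V ^ j"
  using assms
proof (induction j arbitrary: Y)
  case 0
  then show ?case using triple_degree[of Y] finite_V finite_subset by (auto simp: nsets_def)
next
  case (Suc j)
  have fY: "finite Y" using Suc.prems finite_V finite_subset by blast
  have sub: "{q \<in> H. Y \<subseteq> q} \<subseteq> (\<Union>z\<in>V - Y. {q \<in> H. insert z Y \<subseteq> q})"
  proof
    fix q assume q: "q \<in> {q \<in> H. Y \<subseteq> q}"
    then have "card Y < card q" using edgeD(2)[of q] Suc.prems by auto
    then obtain z where "z \<in> q" "z \<notin> Y"
      by (metis card_mono fY leD subsetI)
    then show "q \<in> (\<Union>z\<in>V - Y. {q \<in> H. insert z Y \<subseteq> q})" using q edgeD(1) by auto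
  qed
  have "card {q \<in> H. Y \<subseteq> q} \<le> card (\<Union>z\<in>V - Y. {q \<in> H. insert z Y \<subseteq> q})"
    using finite_H finite_V by (intro card_mono sub) auto
  also have "\<dots> \<le> (\<Sum>z\<in>V - Y. card {q \<in> H. insert z Y \<subseteq> q})"
    using finite_V by (intro card_UN_le) auto
  also have "\<dots> \<le> (\<Sum>z\<in>V - Y. 3 * card V ^ j)"
  proof (rule sum_mono)
    fix z assume "z \<in> V - Y"
    then show "card {q \<in> H. insert z Y \<subseteq> q} \<le> 3 * card V ^ j"
      using Suc.prems fY by (intro Suc.IH) auto
  qed
  also have "\<dots> \<le> card V * (3 * card V ^ j)"
    using finite_V by (simp add: card_mono)
  finally show ?case by (simp add: algebra_simps)
qed

lemma card_H_le: "card H \<le> 3 * card V ^ 3"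
  using degree_le[of "{}" 3] by simp

definition edge_free_subsets :: "'a set \<Rightarrow> 'a set set" where
  "edge_free_subsets X = {I. I \<subseteq> X \<and> edge_free H I}"

definition link_count :: "'a \<Rightarrow> 'a set \<Rightarrow> nat" where
  "link_count v I = card {q \<in> H. v \<in> q \<and> q - {v} \<subseteq> I}"

text \<open>\<open>X\<close> plays the role of a sparse random vertex set around whose element \<open>v\<close> the hypergraph is linear and
  triangle-free.\<close>

definition good :: "'a set \<Rightarrow> 'a \<Rightarrow> bool" where
  "good X v \<longleftrightarrow>
    (\<forall>e\<in>H. \<forall>f\<in>H. e \<subseteq> X \<and> f \<subseteq> X \<and> v \<in> e \<and> e \<noteq> f \<longrightarrow> card (e \<inter> f) \<le> 1) \<and>
    (\<forall>e\<in>H. \<forall>e'\<in>H. \<forall>f\<in>H. e \<subseteq> X \<and> e' \<subseteq> X \<and> f \<subseteq> X \<and> v \<in> e \<and> v \<in> e' \<and> e \<noteq> e' \<and> v \<notin> f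
       \<longrightarrow> e \<inter> f = {} \<or> e' \<inter> f = {})"

lemma finite_edge_free_subsets: "finite X \<Longrightarrow> finite (edge_free_subsets X)"
  unfolding edge_free_subsets_def by (rule finite_subset[of _ "Pow X"]) auto

lemma empty_in_edge_free_subsets: "{} \<in> edge_free_subsets X"
  using edgeD(2) by (fastforce simp: edge_free_subsets_def edge_free_def)

lemma card_edge_free_subsets_pos: "finite X \<Longrightarrow> card (edge_free_subsets X) > 0"
  using empty_in_edge_free_subsets finite_edge_free_subsets card_gt_0_iff by blast

end

section \<open>The local bound at a vertex of a good pair\<close>

text \<open>\<open>S\<close> and its complement \<open>A - S\<close> together meet \<open>B\<close>
  in \<open>card B\<close> elements, so a random subset of \<open>A\<close> contains half of
  \<open>B\<close> on average.\<close>

lemma sum_card_Int_Pow: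
  assumes "finite A" "B \<subseteq> A"
  shows "2 * (\<Sum>S\<in>Pow A. card (S \<inter> B)) = card B * 2 ^ card A"
proof -
  have "(\<Sum>S\<in>Pow A. card (S \<inter> B)) = (\<Sum>S\<in>Pow A. card ((A - S) \<inter> B))"
    by (rule sum.reindex_bij_witness[of _ "\<lambda>S. A - S" "\<lambda>S. A - S"]) (auto simp: double_diff)
  then have "2 * (\<Sum>S\<in>Pow A. card (S \<inter> B)) = (\<Sum>S\<in>Pow A. card (S \<inter> B) + card ((A - S) \<inter> B))"
    by (simp add: sum.distrib)
  also have "\<dots> = (\<Sum>S\<in>Pow A. card B)"
  proof (rule sum.cong)
    fix S assume "S \<in> Pow A"
    have "card (S \<inter> B) + card ((A - S) \<inter> B) = card ((S \<inter> B) \<union> ((A - S) \<inter> B))"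
      using assms finite_subset[of B A] by (intro card_Un_disjoint[symmetric]) auto
    also have "(S \<inter> B) \<union> ((A - S) \<inter> B) = B" using assms by auto
    finally show "card (S \<inter> B) + card ((A - S) \<inter> B) = card B" .
  qed simp
  finally show ?thesis using assms by (simp add: card_Pow)
qed

text \<open>With b = \<open>card B\<close>, a random \<open>S\<close> misses \<open>B\<close> with
  probability 2^(-b) and meets it in b/2 elements on average. The first contribution is large for
  small b, the second for large b; the worst case is near b = log w.\<close>

lemma sum_Pow_avoid_or_hit:
  fixes w :: real
  assumes "finite A" "B \<subseteq> A" "w \<ge> 1"
  shows "ln w / 2 * 2 ^ card A
    \<le> (\<Sum>S\<in>Pow A. w * (if S \<inter> B = {} then 1 else 0) + real (card (S \<inter> B)))"
proof -
  have fB: "finite B" using assms finite_subset by blast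
  have c: "card A = card (A - B) + card B"
    using assms fB card_mono[of A B] by (simp add: card_Diff_subset)
  have "(\<Sum>S\<in>Pow A. if S \<inter> B = {} then 1 else 0 :: real) = real (card {S \<in> Pow A. S \<inter> B = {}})"
    using assms by (simp add: sum.If_cases Int_def)
  also have "{S \<in> Pow A. S \<inter> B = {}} = Pow (A - B)" using assms by auto
  finally have 1: "(\<Sum>S\<in>Pow A. if S \<inter> B = {} then 1 else 0 :: real) = 2 ^ card (A - B)"
    using assms by (simp add: card_Pow)
  have "2 * real (\<Sum>S\<in>Pow A. card (S \<inter> B)) = real (card B) * 2 ^ card A"
    using arg_cong[OF sum_card_Int_Pow[OF assms(1,2)], of real] by simp
  then have 2: "(\<Sum>S\<in>Pow A. real (card (S \<inter> B))) = real (card B) / 2 * 2 ^ card A"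
    by simp
  \<comment> \<open>This splits ln w = ln y + b ln 2 \<le> y + b, where b =
    \<open>card B\<close>.\<close>
  define y where "y = w / 2 ^ card B"
  have y: "y > 0" using assms by (simp add: y_def)
  have "ln w = ln y + card B * ln 2"
    using assms by (simp add: y_def ln_div ln_realpow)
  moreover have "ln y \<le> y" using y ln_le_minus_one[of y] by simp
  moreover have "real (card B) * ln 2 \<le> real (card B) * 1"
    using ln_le_minus_one[of "2::real"] by (intro mult_left_mono) auto
  ultimately have "ln w / 2 \<le> y + card B / 2" using y by linarith
  then have "ln w / 2 * 2 ^ card A \<le> (y + card B / 2) * 2 ^ card A"
    by (intro mult_right_mono) auto
  also have "\<dots> = w * 2 ^ card (A - B) + card B / 2 * 2 ^ card A"
    by (simp add: y_def c power_add field_simps)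
  finally show ?thesis by (simp add: sum.distrib sum_distrib_left[symmetric] 1 2)
qed

context quadruple_system
begin

text \<open>Pick one vertex from each link triple of \<open>v\<close> and let \<open>R\<close> be the set of these. Since \<open>(X, v)\<close> is good,
  no edge avoiding \<open>v\<close> has two vertices in \<open>R\<close>, so after fixing \<open>I - R\<close> the available vertices of \<open>R\<close> can
  be chosen freely.\<close>

lemma good_local_bound:
  fixes w :: real
  assumes X: "X \<subseteq> V" and v: "v \<in> X" and gd: "good X v" and w: "w \<ge> 1"
  defines "Y \<equiv> X - {v}"
  shows "ln w / 2 * real (card (edge_free_subsets Y))
    \<le> w * real (card {I \<in> edge_free_subsets Y. edge_free H (insert v I)}) + (\<Sum>I\<in>edge_free_subsets Y. real (link_count v I))"
proof -
  have finY: "finite Y" using X finite_V finite_subset by (auto simp: Y_def)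
  define L where "L = {q \<in> H. v \<in> q \<and> q \<subseteq> X}"
  have finL: "finite L" using finite_H by (auto simp: L_def)
  have "\<exists>x. x \<in> q - {v}" if "q \<in> L" for q
    using edgeD(2,3)[of q] that card_mono[of "{v}" q] by (fastforce simp: L_def)
  then obtain r where r: "\<And>q. q \<in> L \<Longrightarrow> r q \<in> q - {v}" by metis
  define R where "R = r ` L"
  have R_Y: "R \<subseteq> Y" using r by (auto simp: R_def L_def Y_def)
  \<comment> \<open>By the first half of \<open>good\<close>, the link triples of \<open>v\<close>
    inside \<open>X\<close> are pairwise disjoint.\<close>
  have meet: "q \<inter> q' = {v}" if "q \<in> L" "q' \<in> L" "q \<noteq> q'" for q q'
  proof -
    have sub: "q \<subseteq> X" "q' \<subseteq> X" "v \<in> q" "v \<in> q'" "q \<in> H" "q' \<in> H"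
      using that by (auto simp: L_def)
    then have "card (q \<inter> q') \<le> 1" using gd that(3) unfolding good_def by blast
    moreover have "finite (q \<inter> q')" using edgeD(3)[OF sub(5)] by simp
    ultimately have "x = v" if "x \<in> q \<inter> q'" for x
      using card_le_Suc0_iff_eq[of "q \<inter> q'"] that sub by simp
    then show ?thesis using sub by blast
  qed
  have qR: "q \<inter> R = {r q}" if "q \<in> L" for q
  proof -
    have "x = r q" if x: "x \<in> q" "x \<in> R" for x
    proof -
      obtain q' where q': "q' \<in> L" "x = r q'" using x(2) by (auto simp: R_def)
      then show ?thesis using r[OF q'(1)] meet[OF \<open>q \<in> L\<close> q'(1)] that by auto
    qed
    then show ?thesis using r[OF that] that by (auto simp: R_def)
  qed
  \<comment> \<open>Two vertices of \<open>R\<close> in \<open>f\<close> would come from two edges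
    through \<open>v\<close> that both meet \<open>f\<close>, the triangle excluded by the second
    half of \<open>good\<close>.\<close>
  have fR: "x = y" if f: "f \<in> H" "f \<subseteq> Y" and x: "x \<in> f \<inter> R" and y: "y \<in> f \<inter> R" for f x y
  proof (rule ccontr)
    assume "x \<noteq> y"
    obtain q q' where q: "q \<in> L" "x = r q" "q' \<in> L" "y = r q'" using x y by (auto simp: R_def)
    have "q \<noteq> q'" using q \<open>x \<noteq> y\<close> by blast
    moreover have "x \<in> q" "y \<in> q'" using q r by blast+
    moreover have "v \<notin> f" "f \<subseteq> X" using f by (auto simp: Y_def)
    moreover have "q \<in> H" "q \<subseteq> X" "v \<in> q" "q' \<in> H" "q' \<subseteq> X" "v \<in> q'"
      using q by (auto simp: L_def)
    ultimately have "q \<inter> f = {} \<or> q' \<inter> f = {}"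
      using gd f(1) unfolding good_def by metis
    then show False using x y \<open>x \<in> q\<close> \<open>y \<in> q'\<close> by blast
  qed
  \<comment> \<open>Given the part \<open>J\<close> outside \<open>R\<close>, \<open>A J\<close> are
    the vertices of \<open>R\<close> still available, \<open>B J\<close> those among them that
    complete a link triple of \<open>v\<close> and thereby block \<open>v\<close>, and
    \<open>C J\<close> is the class of edge-free sets with this outside part.\<close>
  define A where "A J = {x \<in> R. edge_free H (insert x J)}" for J
  define B where "B J = {x \<in> A J. \<exists>q\<in>L. r q = x \<and> q - {v, x} \<subseteq> J}" for J
  define C where "C J = {I \<in> edge_free_subsets Y. I - R = J}" for J
  have finR: "finite R" using finL by (simp add: R_def)
  define g where "g I = w * (if edge_free H (insert v I) then 1 else 0) + real (link_count v I)" for I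
  have cls: "ln w / 2 * real (card (C J)) \<le> (\<Sum>I\<in>C J. g I)" if J: "J \<in> (\<lambda>I. I - R) ` edge_free_subsets Y" for J
  proof -
    have JR: "J \<inter> R = {}" and JY: "J \<subseteq> Y" using J by (auto simp: edge_free_subsets_def)
    \<comment> \<open>By \<open>fR\<close> an edge inside \<open>J \<union> S\<close> uses at most
      one vertex of \<open>S\<close>, so availability of single vertices suffices and the class is a
      full power set.\<close>
    have bij: "bij_betw (\<lambda>S. J \<union> S) (Pow (A J)) (C J)"
    proof (rule bij_betw_byWitness[where f' = "\<lambda>I. I \<inter> R"])
      show "\<forall>S\<in>Pow (A J). (J \<union> S) \<inter> R = S" using JR by (auto simp: A_def)
      show "\<forall>I\<in>C J. J \<union> (I \<inter> R) = I" by (auto simp: C_def)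
      show "(\<lambda>I. I \<inter> R) ` C J \<subseteq> Pow (A J)"
        by (auto simp: C_def A_def edge_free_subsets_def intro: edge_free_subset)
      show "(\<lambda>S. J \<union> S) ` Pow (A J) \<subseteq> C J"
      proof safe
        fix S assume S: "S \<subseteq> A J"
        have SR: "S \<subseteq> R" using S by (auto simp: A_def)
        have "edge_free H (J \<union> S)"
          unfolding edge_free_def
        proof safe
          fix f assume f: "f \<in> H" "f \<subseteq> J \<union> S"
          have "\<exists>x. f \<subseteq> insert x J \<and> (x \<in> S \<or> f \<subseteq> J)"
          proof (cases "f \<inter> S = {}")
            case True
            then show ?thesis using f by blast
          next
            case False
            then obtain x where x: "x \<in> f" "x \<in> S" by blast
            then have "y = x" if "y \<in> f" "y \<in> S" for y
              using fR[of f y x] f that SR JY R_Y by blast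
            then show ?thesis using x f by blast
          qed
          then obtain x where x: "f \<subseteq> insert x J" "x \<in> S \<or> f \<subseteq> J" by blast
          from x(2) show False
          proof
            assume "x \<in> S"
            then show False using x S f by (auto simp: A_def edge_free_def)
          next
            assume "f \<subseteq> J"
            moreover obtain I where "I \<in> edge_free_subsets Y" "J = I - R" using J by blast
            ultimately show False using f by (auto simp: edge_free_subsets_def edge_free_def)
          qed
        qed
        then show "J \<union> S \<in> C J" using SR JR JY R_Y by (auto simp: C_def edge_free_subsets_def)
      qed
    qed
    have finA: "finite (A J)" using finR by (auto simp: A_def)
    have BA: "B J \<subseteq> A J" by (auto simp: B_def)
    \<comment> \<open>An edge completed by \<open>v\<close> would contain its representative in
      \<open>S\<close> and have its other two link vertices in \<open>J\<close>, so this
      representative would lie in \<open>B J\<close>.\<close>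
    have free: "edge_free H (insert v (J \<union> S))" if S: "S \<subseteq> A J" "S \<inter> B J = {}" for S
      unfolding edge_free_def
    proof safe
      fix f assume f: "f \<in> H" "f \<subseteq> insert v (J \<union> S)"
      have SR: "S \<subseteq> R" using S by (auto simp: A_def)
      have ind: "edge_free H (J \<union> S)" using bij_betwE[OF bij] S by (auto simp: C_def edge_free_subsets_def)
      have vf: "v \<in> f" using f ind by (auto simp: edge_free_def)
      then have fL: "f \<in> L" using f v SR R_Y JY by (auto simp: L_def Y_def)
      have rf: "r f \<in> S" using r[OF fL] f JR fL by (auto simp: R_def)
      have "f - {v, r f} \<subseteq> J" using f qR[OF fL] SR by blast
      then have "r f \<in> B J" using fL rf S by (auto simp: B_def)
      then show False using S rf by blast
    qed
    \<comment> \<open>Each vertex in \<open>S \<inter> B J\<close> represents a link triple inside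
      \<open>J \<union> S\<close>, and different representatives belong to different
      triples.\<close>
    have cnt: "card (S \<inter> B J) \<le> link_count v (J \<union> S)" if S: "S \<subseteq> A J" for S
    proof -
      have "S \<inter> B J \<subseteq> r ` {q \<in> H. v \<in> q \<and> q - {v} \<subseteq> J \<union> S}"
        by (force simp: B_def L_def)
      then show ?thesis unfolding link_count_def using finite_H
        by (intro surj_card_le) auto
    qed
    have "ln w / 2 * real (card (C J)) = ln w / 2 * 2 ^ card (A J)"
      using bij_betw_same_card[OF bij] finA by (simp add: card_Pow)
    also have "\<dots> \<le> (\<Sum>S\<in>Pow (A J). w * (if S \<inter> B J = {} then 1 else 0) + real (card (S \<inter> B J)))"
      by (rule sum_Pow_avoid_or_hit[OF finA BA w])
    also have "\<dots> \<le> (\<Sum>S\<in>Pow (A J). g (J \<union> S))"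
    proof (rule sum_mono)
      fix S assume "S \<in> Pow (A J)"
      then have S: "S \<subseteq> A J" by simp
      show "w * (if S \<inter> B J = {} then 1 else 0) + real (card (S \<inter> B J)) \<le> g (J \<union> S)"
        using free[OF S] cnt[OF S] w by (auto simp: g_def)
    qed
    also have "\<dots> = (\<Sum>I\<in>C J. g I)"
      using bij by (rule sum.reindex_bij_betw)
    finally show ?thesis .
  qed
  have finI: "finite (edge_free_subsets Y)" using finY by (rule finite_edge_free_subsets)
  have "ln w / 2 * real (card (edge_free_subsets Y)) = (\<Sum>I\<in>edge_free_subsets Y. ln w / 2)" by simp
  also have "\<dots> = (\<Sum>J\<in>(\<lambda>I. I - R) ` edge_free_subsets Y. \<Sum>I\<in>C J. ln w / 2)"
    unfolding C_def by (rule sum.image_gen[OF finI])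
  also have "\<dots> \<le> (\<Sum>J\<in>(\<lambda>I. I - R) ` edge_free_subsets Y. \<Sum>I\<in>C J. g I)"
    by (rule sum_mono) (use cls in \<open>simp add: mult.commute\<close>)
  also have "\<dots> = (\<Sum>I\<in>edge_free_subsets Y. g I)"
    unfolding C_def by (rule sum.image_gen[OF finI, symmetric])
  also have "\<dots> = w * (\<Sum>I\<in>edge_free_subsets Y. if edge_free H (insert v I) then 1 else 0) + (\<Sum>I\<in>edge_free_subsets Y. real (link_count v I))"
    by (simp add: g_def sum.distrib sum_distrib_left)
  also have "(\<Sum>I\<in>edge_free_subsets Y. if edge_free H (insert v I) then 1 else 0 :: real)
    = real (card {I \<in> edge_free_subsets Y. edge_free H (insert v I)})"
    using finI by (simp add: sum.If_cases Int_def)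
  finally show ?thesis .
qed

end

section \<open>Counting the pairs that are not good\<close>

lemma real_card_UN_le:
  assumes "finite C" "real (card C) \<le> a" "\<And>c. c \<in> C \<Longrightarrow> real (card (P c)) \<le> b" "b \<ge> 0"
  shows "real (card (\<Union>c\<in>C. P c)) \<le> a * b"
proof -
  have "real (card (\<Union>c\<in>C. P c)) \<le> (\<Sum>c\<in>C. real (card (P c)))"
    using card_UN_le[OF assms(1), of P] by (metis of_nat_le_iff of_nat_sum)
  also have "\<dots> \<le> real (card C) * b" using assms(3) by (rule sum_bounded_above)
  also have "\<dots> \<le> a * b" using assms by (intro mult_right_mono) auto
  finally show ?thesis .
qed

lemma card_Sigma_le:
  assumes "finite A" "card A \<le> a" "\<And>x. x \<in> A \<Longrightarrow> card (B x) \<le> b"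
  shows "card (Sigma A B) \<le> a * b"
proof (cases "\<forall>x\<in>A. finite (B x)")
  case True
  then have "card (Sigma A B) = (\<Sum>x\<in>A. card (B x))" using assms(1) by simp
  also have "\<dots> \<le> card A * b" using assms(3) by (metis id_apply of_nat_eq_id sum_bounded_above)
  also have "\<dots> \<le> a * b" using assms(2) by simp
  finally show ?thesis .
next
  case False
  then obtain x where x: "x \<in> A" "infinite (B x)" by blast
  have "infinite (Pair x ` B x)" using x by (simp add: finite_image_iff inj_on_def)
  then have "infinite (Sigma A B)" using x finite_subset[of "Pair x ` B x" "Sigma A B"] by auto
  then show ?thesis by simp
qed

context quadruple_system
begin

text \<open>A bad pair contains two edges with two common vertices (6 vertices in all), two edges
  with three common vertices (5 vertices), or a triangle of three edges (9 vertices). Each summand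
  is the number of such configurations, bounded by \<open>degree_le\<close>, times the probability
  that a random \<open>m\<close>-set contains all their vertices.\<close>

lemma card_bad_pairs_le:
  fixes p :: real
  assumes m: "m \<le> card V" and N: "card V > 0"
  defines "N \<equiv> real (card V)" and "p \<equiv> real m / real (card V)"
  shows "real (card {(X, v). X \<in> [V]\<^bsup>m\<^esup> \<and> v \<in> X \<and> \<not> good X v})
    \<le> (216 * N ^ 4 * p ^ 6 + 144 * N ^ 3 * p ^ 5 + 432 * N ^ 6 * p ^ 9) * real (card V choose m)"
proof -
  define P where "P U = {X \<in> [V]\<^bsup>m\<^esup>. U \<subseteq> X}" for U
  define C2 where "C2 = (SIGMA e:H. SIGMA v:e. SIGMA Y:[e]\<^bsup>2\<^esup>. {f \<in> H. Y \<subseteq> f \<and> e \<inter> f = Y})"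
  define C3 where "C3 = (SIGMA e:H. SIGMA v:e. SIGMA Y:[e]\<^bsup>3\<^esup>. {f \<in> H. Y \<subseteq> f \<and> e \<inter> f = Y})"
  \<comment> \<open>Prescribing the intersections exactly fixes the number of vertices: the three
    edges share \<open>v\<close>, \<open>x\<close>, \<open>y\<close> pairwise, which leaves 12 - 3 =
    9.\<close>
  define C9 where "C9 = (SIGMA v:V. SIGMA e:{q \<in> H. {v} \<subseteq> q}. SIGMA e':{q \<in> H. {v} \<subseteq> q \<and> e \<inter> q = {v}}.
    SIGMA x:e. SIGMA y:e' - {x}. {f \<in> H. {x, y} \<subseteq> f \<and> e \<inter> f = {x} \<and> e' \<inter> f = {y}})"
  define B2 where "B2 = (\<Union>(e, v, Y, f)\<in>C2. P (e \<union> f) \<times> {v})"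
  define B3 where "B3 = (\<Union>(e, v, Y, f)\<in>C3. P (e \<union> f) \<times> {v})"
  define B9 where "B9 = (\<Union>(v, e, e', x, y, f)\<in>C9. P (e \<union> e' \<union> f) \<times> {v})"
  define M where "M = real (card V choose m)"
  have p: "p \<ge> 0" by (simp add: p_def)
  have P: "real (card (P U \<times> {v})) \<le> p ^ s * M" if "U \<subseteq> V" "card U = s" for U v s
    using card_supersets_le[OF finite_V that(1) m N] that(2)
    by (simp add: P_def card_cartesian_product p_def M_def)
  note D = edgeD finite_H finite_V
  have fin: "finite C2" "finite C3" "finite C9"
    unfolding C2_def C3_def C9_def using D
    by (intro finite_SigmaI; auto intro!: finite_imp_finite_nsets)+
  \<comment> \<open>The factors follow the nested \<open>SIGMA\<close>: the edge \<open>e\<close>,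
    its vertex \<open>v\<close>, the pair \<open>Y\<close> in \<open>e\<close>, and the edges
    \<open>f\<close> through \<open>Y\<close>.\<close>
  have c2: "card C2 \<le> (3 * card V ^ 3) * (4 * (6 * (3 * card V ^ 1)))"
    unfolding C2_def
  proof (intro card_Sigma_le card_H_le)
    fix e v Y assume e: "e \<in> H" and "v \<in> e" and Y: "Y \<in> [e]\<^bsup>2\<^esup>"
    have "card {f \<in> H. Y \<subseteq> f \<and> e \<inter> f = Y} \<le> card {f \<in> H. Y \<subseteq> f}"
      using D by (intro card_mono) auto
    also have "\<dots> \<le> 3 * card V ^ 1"
      using Y D(1)[OF e] by (intro degree_le) (auto simp: nsets_def)
    finally show "card {f \<in> H. Y \<subseteq> f \<and> e \<inter> f = Y} \<le> 3 * card V ^ 1" .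
  qed (use D in \<open>auto simp: card_nsets choose_two intro!: finite_imp_finite_nsets\<close>)
  have c3: "card C3 \<le> (3 * card V ^ 3) * (4 * (4 * (3 * card V ^ 0)))"
    unfolding C3_def
  proof (intro card_Sigma_le card_H_le)
    fix e v Y assume e: "e \<in> H" and "v \<in> e" and Y: "Y \<in> [e]\<^bsup>3\<^esup>"
    have "card {f \<in> H. Y \<subseteq> f \<and> e \<inter> f = Y} \<le> card {f \<in> H. Y \<subseteq> f}"
      using D by (intro card_mono) auto
    also have "\<dots> \<le> 3 * card V ^ 0"
      using Y D(1)[OF e] by (intro degree_le) (auto simp: nsets_def)
    finally show "card {f \<in> H. Y \<subseteq> f \<and> e \<inter> f = Y} \<le> 3 * card V ^ 0" .
  qed (use D in \<open>auto simp: card_nsets binomial_eq_0 numeral_eq_Suc intro!: finite_imp_finite_nsets\<close>)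
  have c9: "card C9 \<le> card V * ((3 * card V ^ 2) * ((3 * card V ^ 2) * (4 * (4 * (3 * card V ^ 1)))))"
    unfolding C9_def
  proof (intro card_Sigma_le)
    fix v assume v: "v \<in> V"
    show vdeg: "card {q \<in> H. {v} \<subseteq> q} \<le> 3 * card V ^ 2"
      using v by (intro degree_le) auto
    fix e e' x y
    assume e: "e \<in> {q \<in> H. {v} \<subseteq> q}"
    have "card {q \<in> H. {v} \<subseteq> q \<and> e \<inter> q = {v}} \<le> card {q \<in> H. {v} \<subseteq> q}"
      using D by (intro card_mono) auto
    also have "\<dots> \<le> 3 * card V ^ 2" by (rule vdeg)
    finally show "card {q \<in> H. {v} \<subseteq> q \<and> e \<inter> q = {v}} \<le> 3 * card V ^ 2" .
    assume e': "e' \<in> {q \<in> H. {v} \<subseteq> q \<and> e \<inter> q = {v}}" and x: "x \<in> e"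
    show "card (e' - {x}) \<le> 4" using D(2,3)[of e'] e' card_mono[of e' "e' - {x}"] by auto
    assume y: "y \<in> e' - {x}"
    have "card {f \<in> H. {x, y} \<subseteq> f \<and> e \<inter> f = {x} \<and> e' \<inter> f = {y}} \<le> card {f \<in> H. {x, y} \<subseteq> f}"
      using D by (intro card_mono) auto
    also have "\<dots> \<le> 3 * card V ^ 1"
      using x y e e' D(1) by (intro degree_le) auto
    finally show "card {f \<in> H. {x, y} \<subseteq> f \<and> e \<inter> f = {x} \<and> e' \<inter> f = {y}} \<le> 3 * card V ^ 1" .
  qed (use D in auto)
  have union: "card (e \<union> f) = 8 - s" if "e \<in> H" "f \<in> H" "card (e \<inter> f) = s" for e f s
    using card_Un_Int[of e f] D(2,3) that by auto
  have "real (card B2) \<le> (216 * N ^ 4) * (p ^ 6 * M)"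
    unfolding B2_def
  proof (rule real_card_UN_le)
    have "real (card C2) \<le> real ((3 * card V ^ 3) * (4 * (6 * (3 * card V ^ 1))))"
      using c2 of_nat_le_iff by blast
    then show "real (card C2) \<le> 216 * N ^ 4" by (simp add: N_def eval_nat_numeral algebra_simps)
    fix c assume c: "c \<in> C2"
    obtain e v Y f where "c = (e, v, Y, f)" by (cases c) auto
    with c have "c = (e, v, Y, f)" "e \<in> H" "f \<in> H" "card (e \<inter> f) = 2"
      by (auto simp: C2_def nsets_def)
    then show "real (card (case c of (e, v, Y, f) \<Rightarrow> P (e \<union> f) \<times> {v})) \<le> p ^ 6 * M"
      using D(1) union[of e f 2] by (auto intro!: P)
  qed (use fin p in \<open>auto simp: M_def\<close>)
  moreover have "real (card B3) \<le> (144 * N ^ 3) * (p ^ 5 * M)"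
    unfolding B3_def
  proof (rule real_card_UN_le)
    have "real (card C3) \<le> real ((3 * card V ^ 3) * (4 * (4 * (3 * card V ^ 0))))"
      using c3 of_nat_le_iff by blast
    then show "real (card C3) \<le> 144 * N ^ 3" by (simp add: N_def algebra_simps)
    fix c assume c: "c \<in> C3"
    obtain e v Y f where "c = (e, v, Y, f)" by (cases c) auto
    with c have "c = (e, v, Y, f)" "e \<in> H" "f \<in> H" "card (e \<inter> f) = 3"
      by (auto simp: C3_def nsets_def)
    then show "real (card (case c of (e, v, Y, f) \<Rightarrow> P (e \<union> f) \<times> {v})) \<le> p ^ 5 * M"
      using D(1) union[of e f 3] by (auto intro!: P)
  qed (use fin p in \<open>auto simp: M_def\<close>)
  moreover have "real (card B9) \<le> (432 * N ^ 6) * (p ^ 9 * M)"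
    unfolding B9_def
  proof (rule real_card_UN_le)
    have "real (card C9) \<le> real (card V * ((3 * card V ^ 2) * ((3 * card V ^ 2) * (4 * (4 * (3 * card V ^ 1))))))"
      using c9 of_nat_le_iff by blast
    then show "real (card C9) \<le> 432 * N ^ 6" by (simp add: N_def eval_nat_numeral algebra_simps)
    fix c assume c: "c \<in> C9"
    obtain v e e' x y f where "c = (v, e, e', x, y, f)" by (cases c) auto
    with c have c': "c = (v, e, e', x, y, f)" "e \<in> H" "e' \<in> H" "f \<in> H" "e \<inter> e' = {v}"
      "e \<inter> f = {x}" "e' \<inter> f = {y}" "x \<noteq> y"
      by (auto simp: C9_def)
    have "card (e \<union> e') = 7" using union[of e e' 1] c' by simp
    moreover have "(e \<union> e') \<inter> f = {x, y}" using c' by auto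
    ultimately have "card (e \<union> e' \<union> f) = 9"
      using card_Un_Int[of "e \<union> e'" f] D(2,3) c' by auto
    then show "real (card (case c of (v, e, e', x, y, f) \<Rightarrow> P (e \<union> e' \<union> f) \<times> {v})) \<le> p ^ 9 * M"
      using D(1) c' by (auto intro!: P)
  qed (use fin p in \<open>auto simp: M_def\<close>)
  moreover have "{(X, v). X \<in> [V]\<^bsup>m\<^esup> \<and> v \<in> X \<and> \<not> good X v} \<subseteq> B2 \<union> B3 \<union> B9"
  proof clarify
    fix X v assume X: "X \<in> [V]\<^bsup>m\<^esup>" "v \<in> X" "\<not> good X v" and nB: "(X, v) \<notin> B9" "(X, v) \<notin> B3"
    show "(X, v) \<in> B2"
    proof (rule ccontr)
      assume nB2: "(X, v) \<notin> B2"
      \<comment> \<open>Intersections of size 2 and 3 are recorded in \<open>B2\<close> and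
        \<open>B3\<close>, and size 4 would give \<open>e = f\<close>.\<close>
      have 1: "card (e \<inter> f) \<le> 1" if "e \<in> H" "f \<in> H" "e \<subseteq> X" "f \<subseteq> X" "v \<in> e" "e \<noteq> f" for e f
      proof -
        have "card (e \<inter> f) \<noteq> 4"
          using that D(2,3) card_subset_eq[of e "e \<inter> f"] card_subset_eq[of f "e \<inter> f"] by (metis inf_le1 inf_le2)
        moreover have "card (e \<inter> f) \<le> 4" using D(2,3) that card_mono[of e "e \<inter> f"] by auto
        moreover have "card (e \<inter> f) \<noteq> 2"
        proof
          assume "card (e \<inter> f) = 2"
          then have "(e, v, e \<inter> f, f) \<in> C2" using that D(3) by (auto simp: C2_def nsets_def)
          moreover have "(X, v) \<in> P (e \<union> f) \<times> {v}" using that X(1) by (simp add: P_def)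
          ultimately have "(X, v) \<in> B2" unfolding B2_def by (intro UN_I[of "(e, v, e \<inter> f, f)"]) simp_all
          then show False using nB2 by simp
        qed
        moreover have "card (e \<inter> f) \<noteq> 3"
        proof
          assume "card (e \<inter> f) = 3"
          then have "(e, v, e \<inter> f, f) \<in> C3" using that D(3) by (auto simp: C3_def nsets_def)
          moreover have "(X, v) \<in> P (e \<union> f) \<times> {v}" using that X(1) by (simp add: P_def)
          ultimately have "(X, v) \<in> B3" unfolding B3_def by (intro UN_I[of "(e, v, e \<inter> f, f)"]) simp_all
          then show False using nB by simp
        qed
        ultimately show ?thesis by linarith
      qed
      have 2: "e \<inter> f = {} \<or> e' \<inter> f = {}"
        if h: "e \<in> H" "e' \<in> H" "f \<in> H" "e \<subseteq> X" "e' \<subseteq> X" "f \<subseteq> X" "v \<in> e" "v \<in> e'" "e \<noteq> e'" "v \<notin> f" for e e' f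
      proof (rule ccontr)
        assume "\<not> (e \<inter> f = {} \<or> e' \<inter> f = {})"
        then obtain x y where xy: "x \<in> e" "x \<in> f" "y \<in> e'" "y \<in> f" by blast
        have one: "A = {a}" if "card A \<le> 1" "a \<in> A" "finite A" for A and a :: 'a
          using that card_le_Suc0_iff_eq[of A] by auto
        have "e \<noteq> f" "e' \<noteq> f" using h by auto
        have "e \<inter> f = {x}" by (rule one) (use 1[of e f] xy h \<open>e \<noteq> f\<close> D(3) in auto)
        moreover have "e' \<inter> f = {y}" by (rule one) (use 1[of e' f] xy h \<open>e' \<noteq> f\<close> D(3) in auto)
        moreover have "e \<inter> e' = {v}" by (rule one) (use 1[of e e'] h D(3) in auto)
        ultimately have i: "e \<inter> f = {x}" "e' \<inter> f = {y}" "e \<inter> e' = {v}" by auto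
        have "x \<noteq> y"
        proof
          assume "x = y"
          then have "x \<in> e \<inter> e'" using xy by simp
          then show False using i(3) xy h(10) by simp
        qed
        have "v \<in> V" using D(1)[OF h(1)] h(7) by blast
        have "(v, e, e', x, y, f) \<in> C9"
          unfolding C9_def
          by (intro SigmaI CollectI conjI) (use \<open>x \<noteq> y\<close> \<open>v \<in> V\<close> i xy h in simp_all)
        moreover have "(X, v) \<in> P (e \<union> e' \<union> f) \<times> {v}" using h X(1) by (simp add: P_def)
        ultimately have "(X, v) \<in> B9" unfolding B9_def by (intro UN_I[of "(v, e, e', x, y, f)"]) simp_all
        then show False using nB by simp
      qed
      have "good X v" unfolding good_def using 1 2 by blast
      then show False using X by simp
    qed
  qed
  moreover have "finite (B2 \<union> B3 \<union> B9)"
  proof -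
    have "finite (P U)" for U
      unfolding P_def using finite_imp_finite_nsets[OF finite_V] by simp
    then show ?thesis using fin unfolding B2_def B3_def B9_def by auto
  qed
  ultimately have "real (card {(X, v). X \<in> [V]\<^bsup>m\<^esup> \<and> v \<in> X \<and> \<not> good X v}) \<le> real (card (B2 \<union> B3 \<union> B9))"
    by (simp add: card_mono)
  also have "\<dots> \<le> real (card B2) + real (card B3) + real (card B9)"
    using card_Un_le[of "B2 \<union> B3" B9] card_Un_le[of B2 B3] by linarith
  also have "\<dots> \<le> (216 * N ^ 4) * (p ^ 6 * M) + (144 * N ^ 3) * (p ^ 5 * M) + (432 * N ^ 6) * (p ^ 9 * M)"
    by (intro add_mono) fact+
  finally show ?thesis by (simp add: M_def algebra_simps)
qed

end

section \<open>Averaging over the sample and its edge-free subsets\<close>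

context quadruple_system
begin

text \<open>Deleting \<open>v\<close> maps the edge-free sets containing \<open>v\<close>
  injectively to those avoiding it. Hence passing from \<open>X - {v}\<close> to \<open>X\<close> at
  most doubles the number of edge-free subsets.\<close>

lemma card_edge_free_subsets_split:
  assumes "finite X" "v \<in> X"
  shows "card {I \<in> edge_free_subsets (X - {v}). edge_free H (insert v I)} = card {I \<in> edge_free_subsets X. v \<in> I}"
    and "card (edge_free_subsets X) = card (edge_free_subsets (X - {v})) + card {I \<in> edge_free_subsets X. v \<in> I}"
    and "card {I \<in> edge_free_subsets X. v \<in> I} \<le> card (edge_free_subsets (X - {v}))"
proof -
  have "bij_betw (insert v) {I \<in> edge_free_subsets (X - {v}). edge_free H (insert v I)} {I \<in> edge_free_subsets X. v \<in> I}"
    using assms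
    by (intro bij_betw_byWitness[where f' = "\<lambda>I. I - {v}"])
       (auto simp: edge_free_subsets_def insert_absorb intro: edge_free_subset)
  then show 1: "card {I \<in> edge_free_subsets (X - {v}). edge_free H (insert v I)} = card {I \<in> edge_free_subsets X. v \<in> I}"
    by (rule bij_betw_same_card)
  have "edge_free_subsets X = edge_free_subsets (X - {v}) \<union> {I \<in> edge_free_subsets X. v \<in> I}" by (auto simp: edge_free_subsets_def)
  moreover have "edge_free_subsets (X - {v}) \<inter> {I \<in> edge_free_subsets X. v \<in> I} = {}" by (auto simp: edge_free_subsets_def)
  ultimately show "card (edge_free_subsets X) = card (edge_free_subsets (X - {v})) + card {I \<in> edge_free_subsets X. v \<in> I}"
    using finite_edge_free_subsets assms by (metis card_Un_disjoint finite_Un)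
  show "card {I \<in> edge_free_subsets X. v \<in> I} \<le> card (edge_free_subsets (X - {v}))"
    unfolding 1[symmetric] using finite_edge_free_subsets assms by (intro card_mono) auto
qed

lemma sum_card_edge_free_subsets_le:
  assumes "finite X" "\<And>I. I \<in> edge_free_subsets X \<Longrightarrow> card I \<le> k"
  shows "(\<Sum>v\<in>X. card {I \<in> edge_free_subsets X. v \<in> I}) \<le> k * card (edge_free_subsets X)"
proof -
  have "(\<Sum>v\<in>X. card {I \<in> edge_free_subsets X. v \<in> I}) = (\<Sum>v\<in>X. \<Sum>I\<in>edge_free_subsets X. if v \<in> I then 1 else 0)"
    using finite_edge_free_subsets[OF assms(1)] by (simp add: sum.If_cases Int_def)
  also have "\<dots> = (\<Sum>I\<in>edge_free_subsets X. \<Sum>v\<in>X. if v \<in> I then 1 else 0)" by (rule sum.swap)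
  also have "\<dots> = (\<Sum>I\<in>edge_free_subsets X. card I)"
  proof (rule sum.cong)
    fix I assume "I \<in> edge_free_subsets X"
    then have "{v \<in> X. v \<in> I} = I" by (auto simp: edge_free_subsets_def)
    then show "(\<Sum>v\<in>X. if v \<in> I then 1 else 0) = card I"
      using assms(1) by (simp add: sum.If_cases Int_def)
  qed simp
  also have "\<dots> \<le> of_nat (card (edge_free_subsets X)) * k" using assms(2) by (rule sum_bounded_above)
  finally show ?thesis by (simp add: mult.commute)
qed

text \<open>A counted pair of \<open>v\<close> and \<open>q\<close> is determined by the triple
  \<open>q - {v}\<close> of \<open>I\<close> and the edge \<open>q\<close> above it; there are at
  most k^3 triples with at most three edges each.\<close>

lemma sum_link_count_le:
  assumes "I \<subseteq> V" "card I \<le> k"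
  shows "(\<Sum>v\<in>V. link_count v I) \<le> 3 * k ^ 3"
proof -
  have fI: "finite I" using assms finite_V finite_subset by blast
  define S where "S = (SIGMA T:[I]\<^bsup>3\<^esup>. {q \<in> H. T \<subseteq> q})"
  have fS: "finite S" unfolding S_def using fI finite_H by (auto intro!: finite_imp_finite_nsets)
  have "(\<Sum>v\<in>V. link_count v I) = card (SIGMA v:V. {q \<in> H. v \<in> q \<and> q - {v} \<subseteq> I})"
    unfolding link_count_def using finite_V finite_H by simp
  also have "\<dots> \<le> card S"
  proof (rule card_inj_on_le[OF _ _ fS])
    show "inj_on (\<lambda>(v, q). (q - {v}, q)) (SIGMA v:V. {q \<in> H. v \<in> q \<and> q - {v} \<subseteq> I})"
      by (auto simp: inj_on_def)
    show "(\<lambda>(v, q). (q - {v}, q)) ` (SIGMA v:V. {q \<in> H. v \<in> q \<and> q - {v} \<subseteq> I}) \<subseteq> S"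
      using edgeD by (auto simp: S_def nsets_def)
  qed
  also have "\<dots> \<le> (k ^ 3) * 3"
    unfolding S_def
  proof (rule card_Sigma_le)
    show "finite ([I]\<^bsup>3\<^esup>)" using fI by (rule finite_imp_finite_nsets)
    have "card I choose 3 \<le> card I ^ 3" by (cases "3 \<le> card I") (auto intro: binomial_le_pow simp: binomial_eq_0)
    then show "card ([I]\<^bsup>3\<^esup>) \<le> k ^ 3"
      using order_trans[OF _ power_mono[OF assms(2), of 3]] by (simp add: card_nsets)
    fix T assume "T \<in> [I]\<^bsup>3\<^esup>"
    then show "card {q \<in> H. T \<subseteq> q} \<le> 3" using assms(1) by (intro triple_degree) (auto simp: nsets_def)
  qed
  finally show ?thesis by simp
qed

text \<open>The sets \<open>X - {v}\<close> and the vertices \<open>v\<close> range over pairs of an \<open>(m - 1)\<close>-set and a further vertex; this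
  is what turns the link counts into a count of all triples of \<open>I\<close>, a fraction \<open>m/N\<close> of the trivial bound.\<close>

lemma average_bound:
  fixes w :: real
  assumes m: "0 < m" "2 * m \<le> card V" and w: "w \<ge> 1"
    and k: "\<And>I. I \<subseteq> V \<Longrightarrow> edge_free H I \<Longrightarrow> card I \<le> k"
    and bad: "2 * real (card {(X, v). X \<in> [V]\<^bsup>m\<^esup> \<and> v \<in> X \<and> \<not> good X v}) \<le> real m * real (card V choose m)"
  shows "ln w / 4 \<le> 2 * w * real k / real m + 6 * real k ^ 3 / real (card V)"
proof -
  define M where "M = real (card V choose m)"
  have Mpos: "M > 0" using m by (simp add: M_def)
  define P where "P = (SIGMA X:[V]\<^bsup>m\<^esup>. X)"
  define G where "G = {(X, v) \<in> P. good X v}"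
  \<comment> \<open>Divided by the number of edge-free sets, \<open>a X v\<close> is the probability
    that a random edge-free subset of \<open>X\<close> contains \<open>v\<close>;
    \<open>\<tau> Y v\<close> is the expected link count of \<open>v\<close> in a random edge-free
    subset of \<open>Y\<close>.\<close>
  define a where "a X v = real (card {I \<in> edge_free_subsets X. v \<in> I})" for X v
  define \<tau> where "\<tau> Y v = (\<Sum>I\<in>edge_free_subsets Y. real (link_count v I)) / real (card (edge_free_subsets Y))" for Y v
  have fin: "finite ([V]\<^bsup>j\<^esup>)" for j using finite_V by (rule finite_imp_finite_nsets)
  have X: "X \<subseteq> V" "finite X" "card X = j" if "X \<in> [V]\<^bsup>j\<^esup>" for X j
    using that by (auto simp: nsets_def)
  have finP: "finite P" unfolding P_def using fin X(2) by auto
  have pos: "real (card (edge_free_subsets Y)) > 0" if "finite Y" for Y using card_edge_free_subsets_pos[OF that] by simp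
  have "card P = (\<Sum>X\<in>[V]\<^bsup>m\<^esup>. card X)" unfolding P_def using fin X(2) by simp
  also have "\<dots> = (\<Sum>X\<in>[V]\<^bsup>m\<^esup>. m)" using X(3) by (intro sum.cong) auto
  finally have cardP: "real (card P) = real m * M" by (simp add: card_nsets M_def)
  define B where "B = {(X, v). X \<in> [V]\<^bsup>m\<^esup> \<and> v \<in> X \<and> \<not> good X v}"
  have "P = G \<union> B" by (auto simp: P_def G_def B_def)
  then have "card P \<le> card G + card B" by (simp add: card_Un_le)
  then have "real (card P) \<le> real (card G) + real (card B)" by linarith
  moreover have "2 * real (card B) \<le> real m * M" using bad unfolding B_def M_def .
  ultimately have cardG: "real (card G) \<ge> real m * M / 2" using cardP by linarith
  have loc: "ln w / 2 \<le> w * (a X v / real (card (edge_free_subsets (X - {v})))) + \<tau> (X - {v}) v" if "(X, v) \<in> G" for X v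
  proof -
    have Xv: "X \<subseteq> V" "v \<in> X" "good X v" "finite X"
      using that X by (auto simp: G_def P_def)
    have "ln w / 2 * real (card (edge_free_subsets (X - {v}))) \<le> w * a X v + (\<Sum>I\<in>edge_free_subsets (X - {v}). real (link_count v I))"
      using good_local_bound[OF Xv(1-3) w] card_edge_free_subsets_split(1)[OF Xv(4,2)] by (simp add: a_def)
    then show ?thesis
      using pos[of "X - {v}"] Xv(4) by (simp add: \<tau>_def field_simps)
  qed
  have "real m * M / 2 * (ln w / 2) \<le> real (card G) * (ln w / 2)"
    using cardG w by (intro mult_right_mono) auto
  also have "\<dots> = (\<Sum>z\<in>G. ln w / 2)" by simp
  also have "\<dots> \<le> (\<Sum>(X, v)\<in>G. w * (a X v / real (card (edge_free_subsets (X - {v})))) + \<tau> (X - {v}) v)"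
    using loc by (intro sum_mono) auto
  also have "\<dots> \<le> (\<Sum>(X, v)\<in>P. w * (a X v / real (card (edge_free_subsets (X - {v})))) + \<tau> (X - {v}) v)"
    using finP w by (intro sum_mono2) (auto simp: G_def a_def \<tau>_def sum_nonneg)
  also have "\<dots> = w * (\<Sum>(X, v)\<in>P. a X v / real (card (edge_free_subsets (X - {v})))) + (\<Sum>(X, v)\<in>P. \<tau> (X - {v}) v)"
    by (simp add: case_prod_unfold sum.distrib sum_distrib_left)
  \<comment> \<open>For fixed \<open>X\<close> the membership probabilities sum to the mean size of
    an edge-free set, at most \<open>k\<close>; the factor 2 pays for normalizing by
    \<open>X - {v}\<close> instead of \<open>X\<close>.\<close>
  also have "(\<Sum>(X, v)\<in>P. a X v / real (card (edge_free_subsets (X - {v})))) \<le> M * (2 * real k)"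
  proof -
    have "(\<Sum>v\<in>X. a X v / real (card (edge_free_subsets (X - {v})))) \<le> 2 * real k" if "X \<in> [V]\<^bsup>m\<^esup>" for X
    proof -
      note fX = X(2)[OF that]
      have "(\<Sum>v\<in>X. a X v / real (card (edge_free_subsets (X - {v})))) \<le> (\<Sum>v\<in>X. 2 * (a X v / real (card (edge_free_subsets X))))"
      proof (rule sum_mono)
        fix v assume v: "v \<in> X"
        have "real (card (edge_free_subsets X)) \<le> 2 * real (card (edge_free_subsets (X - {v})))"
          using card_edge_free_subsets_split(2,3)[OF fX v] by linarith
        then have "a X v * real (card (edge_free_subsets X)) \<le> a X v * (2 * real (card (edge_free_subsets (X - {v}))))"
          by (intro mult_left_mono) (auto simp: a_def)
        then show "a X v / real (card (edge_free_subsets (X - {v}))) \<le> 2 * (a X v / real (card (edge_free_subsets X)))"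
          using pos[of "X - {v}"] pos[of X] fX by (simp add: field_simps)
      qed
      also have "\<dots> = 2 * (real (\<Sum>v\<in>X. card {I \<in> edge_free_subsets X. v \<in> I}) / real (card (edge_free_subsets X)))"
        by (simp add: a_def sum_distrib_left sum_divide_distrib)
      also have "real (\<Sum>v\<in>X. card {I \<in> edge_free_subsets X. v \<in> I}) \<le> real (k * card (edge_free_subsets X))"
        unfolding of_nat_le_iff using X(1)[OF that] k
        by (intro sum_card_edge_free_subsets_le fX) (auto simp: edge_free_subsets_def)
      finally show ?thesis using pos[OF fX] by (simp add: divide_right_mono)
    qed
    then have "(\<Sum>X\<in>[V]\<^bsup>m\<^esup>. \<Sum>v\<in>X. a X v / real (card (edge_free_subsets (X - {v})))) \<le> (\<Sum>X\<in>[V]\<^bsup>m\<^esup>. 2 * real k)"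
      by (rule sum_mono)
    also have "\<dots> = M * (2 * real k)" by (simp add: card_nsets M_def)
    finally show ?thesis
      unfolding P_def using fin X(2) by (subst sum.Sigma[symmetric]) auto
  qed
  also have "(\<Sum>(X, v)\<in>P. \<tau> (X - {v}) v) \<le> 2 * real m * M / real (card V) * (3 * real k ^ 3)"
  proof -
    define \<phi> where "\<phi> = (\<lambda>(X, v). (X - {v}, v :: 'a))"
    have inj: "inj_on \<phi> P"
      by (auto simp: inj_on_def \<phi>_def P_def)
    have "(\<Sum>(X, v)\<in>P. \<tau> (X - {v}) v) = (\<Sum>(Y, v)\<in>\<phi> ` P. \<tau> Y v)"
      by (subst sum.reindex[OF inj]) (simp add: \<phi>_def case_prod_unfold)
    also have "\<dots> \<le> (\<Sum>(Y, v)\<in>nsets V (m - 1) \<times> V. \<tau> Y v)"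
    proof (rule sum_mono2)
      show "finite (nsets V (m - 1) \<times> V)" using fin finite_V by simp
      show "\<phi> ` P \<subseteq> nsets V (m - 1) \<times> V" by (auto simp: \<phi>_def P_def nsets_def)
    qed (auto simp: \<tau>_def sum_nonneg)
    also have "\<dots> = (\<Sum>Y\<in>nsets V (m - 1). \<Sum>v\<in>V. \<tau> Y v)"
      by (rule sum.cartesian_product[symmetric])
    also have "\<dots> \<le> (\<Sum>Y\<in>nsets V (m - 1). 3 * real k ^ 3)"
    proof (rule sum_mono)
      fix Y assume Y: "Y \<in> nsets V (m - 1)"
      have "(\<Sum>v\<in>V. \<tau> Y v) = (\<Sum>v\<in>V. \<Sum>I\<in>edge_free_subsets Y. real (link_count v I)) / real (card (edge_free_subsets Y))"
        by (simp add: \<tau>_def sum_divide_distrib)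
      also have "(\<Sum>v\<in>V. \<Sum>I\<in>edge_free_subsets Y. real (link_count v I)) = (\<Sum>I\<in>edge_free_subsets Y. \<Sum>v\<in>V. real (link_count v I))"
        by (rule sum.swap)
      also have "\<dots> \<le> of_nat (card (edge_free_subsets Y)) * (3 * real k ^ 3)"
      proof (rule sum_bounded_above)
        fix I assume "I \<in> edge_free_subsets Y"
        then have I: "I \<subseteq> V" "edge_free H I" using X(1)[OF Y] by (auto simp: edge_free_subsets_def)
        have "real (\<Sum>v\<in>V. link_count v I) \<le> real (3 * k ^ 3)"
          using sum_link_count_le[OF I(1) k[OF I]] of_nat_le_iff by blast
        then show "(\<Sum>v\<in>V. real (link_count v I)) \<le> 3 * real k ^ 3" by simp
      qed
      finally show "(\<Sum>v\<in>V. \<tau> Y v) \<le> 3 * real k ^ 3"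
        using pos[OF X(2)[OF Y]] by (simp add: divide_right_mono)
    qed
    also have "\<dots> = real (card V choose (m - 1)) * (3 * real k ^ 3)" by (simp add: card_nsets)
    \<comment> \<open>With N = \<open>card V\<close>, the ratio of the binomial coefficients of N at
      m - 1 and m is m/(N - m + 1), at most 2m/N since 2m \<le> N.\<close>
    also have "\<dots> \<le> 2 * real m * M / real (card V) * (3 * real k ^ 3)"
    proof (rule mult_right_mono)
      obtain j where j: "m = Suc j" using m(1) gr0_conv_Suc by blast
      define N where "N = card V"
      have "(N choose j) * (N - j) = (N choose Suc j) * Suc j"
        by (metis binomial_absorb_comp binomial_absorption mult.commute)
      then have "real (N choose j) * real (N - j) = real m * M"
        unfolding M_def N_def j by (metis mult.commute of_nat_mult)
      moreover have "real (N choose j) * (real N / 2) \<le> real (N choose j) * real (N - j)"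
        using m j by (intro mult_left_mono) (auto simp: N_def of_nat_diff)
      ultimately have "real (N choose j) * real N \<le> 2 * real m * M" by simp
      then show "real (card V choose (m - 1)) \<le> 2 * real m * M / real (card V)"
        using m by (simp add: N_def j field_simps)
    qed simp
    finally show ?thesis .
  qed
  finally have "real m * M / 2 * (ln w / 2) \<le> w * (M * (2 * real k)) + 2 * real m * M / real (card V) * (3 * real k ^ 3)"
    using w by simp
  moreover have "(real m * M) * (2 * w * real k / real m + 6 * real k ^ 3 / real (card V))
    = w * (M * (2 * real k)) + 2 * real m * M / real (card V) * (3 * real k ^ 3)"
    using m by (simp add: field_simps)
  ultimately have "(real m * M) * (ln w / 4) \<le> (real m * M) * (2 * w * real k / real m + 6 * real k ^ 3 / real (card V))"
    by (simp add: algebra_simps)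
  then show ?thesis using m Mpos by simp
qed

end

section \<open>Rainbow cliques in properly colored complete graphs\<close>

definition clashes :: "'a set \<Rightarrow> ('a set \<Rightarrow> nat) \<Rightarrow> 'a set set" where
  "clashes V c = {q \<in> [V]\<^bsup>4\<^esup>. \<exists>e\<in>[V]\<^bsup>2\<^esup>. \<exists>f\<in>[V]\<^bsup>2\<^esup>. e \<union> f = q \<and> e \<inter> f = {} \<and> c e = c f}"

lemma quadruple_system_clashes:
  assumes "finite V" and c: "proper_edge_coloring (V, [V]\<^bsup>2\<^esup>) c"
  shows "quadruple_system V (clashes V c)"
proof
  fix Y :: "'a set" assume Y: "Y \<in> [V]\<^bsup>3\<^esup>"
  then have Y': "Y \<subseteq> V" "finite Y" "card Y = 3" by (auto simp: nsets_def)
  \<comment> \<open>The candidates for the fourth vertex of a clash through \<open>Y\<close> that is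
    paired with \<open>a\<close>. Two of them would give two edges at \<open>a\<close> of the same
    color.\<close>
  define S where "S a = {t \<in> V - Y. c {t, a} = c (Y - {a})}" for a
  have S: "card (S a) \<le> 1" if "a \<in> Y" for a
  proof -
    have "t = t'" if t: "t \<in> S a" "t' \<in> S a" for t t'
    proof (rule ccontr)
      assume "t \<noteq> t'"
      then have "{t, a} \<noteq> {t', a}" by (auto simp: doubleton_eq_iff)
      moreover have "{t, a} \<in> [V]\<^bsup>2\<^esup>" "{t', a} \<in> [V]\<^bsup>2\<^esup>"
        using t \<open>a \<in> Y\<close> Y' by (auto simp: S_def nsets_def card_2_iff)
      ultimately have "c {t, a} \<noteq> c {t', a}"
        using c unfolding proper_edge_coloring_def by auto
      then show False using t by (simp add: S_def)
    qed
    then show ?thesis by (metis One_nat_def card_le_Suc0_iff_eq card.infinite le0)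
  qed
  have finS: "finite (S a)" for a using assms by (simp add: S_def)
  have "{q \<in> clashes V c. Y \<subseteq> q} \<subseteq> (\<Union>a\<in>Y. (\<lambda>t. insert t Y) ` S a)"
  proof
    fix q assume q: "q \<in> {q \<in> clashes V c. Y \<subseteq> q}"
    then obtain e f where ef: "e \<in> [V]\<^bsup>2\<^esup>" "f \<in> [V]\<^bsup>2\<^esup>" "e \<union> f = q" "e \<inter> f = {}" "c e = c f"
      and q4: "card q = 4" "finite q" "q \<subseteq> V" "Y \<subseteq> q"
      by (auto simp: clashes_def nsets_def)
    have "card (q - Y) = 1" using q4 Y' by (simp add: card_Diff_subset)
    then obtain t where t: "q - Y = {t}" by (auto simp: card_1_singleton_iff)
    \<comment> \<open>Stated for arbitrary \<open>e\<close> and \<open>f\<close>, as the new vertex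
      \<open>t\<close> may lie in either of the two edges.\<close>
    have claim: "\<exists>a\<in>Y. t \<in> S a"
      if h: "e \<in> [V]\<^bsup>2\<^esup>" "e \<union> f = q" "e \<inter> f = {}" "c e = c f" "t \<in> e" for e f
    proof -
      obtain a where a: "e = {t, a}" "a \<noteq> t"
        using h by (auto simp: nsets_def card_2_iff doubleton_eq_iff)
      have "a \<in> Y" using a h t by blast
      moreover have "f = Y - {a}" using a h t q4 by blast
      moreover have "t \<in> V - Y" using t q4 by blast
      ultimately show ?thesis using a h(4) by (auto simp: S_def)
    qed
    have "t \<in> e \<or> t \<in> f" using t ef by blast
    then have "\<exists>a\<in>Y. t \<in> S a"
    proof
      assume "t \<in> e" then show ?thesis using claim[of e f] ef by blast
    next
      assume "t \<in> f" then show ?thesis using claim[of f e] ef by (simp add: Un_commute Int_commute)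
    qed
    moreover have "q = insert t Y" using t q4 by blast
    ultimately show "q \<in> (\<Union>a\<in>Y. (\<lambda>t. insert t Y) ` S a)" by blast
  qed
  then have "card {q \<in> clashes V c. Y \<subseteq> q} \<le> card (\<Union>a\<in>Y. (\<lambda>t. insert t Y) ` S a)"
    using finS Y' by (intro card_mono) auto
  also have "\<dots> \<le> (\<Sum>a\<in>Y. card ((\<lambda>t. insert t Y) ` S a))" using Y' by (intro card_UN_le) auto
  also have "\<dots> \<le> (\<Sum>a\<in>Y. 1)"
    using S finS by (intro sum_mono) (meson card_image_le order_trans)
  finally show "card {q \<in> clashes V c. Y \<subseteq> q} \<le> 3" using Y' by simp
qed (use assms in \<open>auto simp: clashes_def\<close>)

text \<open>Adjacent edges differ in color by properness, and disjoint edges of one color would form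
  a clash.\<close>

lemma clash_free_rainbow:
  assumes c: "proper_edge_coloring (V, [V]\<^bsup>2\<^esup>) c"
    and I: "I \<subseteq> V" "edge_free (clashes V c) I"
  shows "inj_on c ([I]\<^bsup>2\<^esup>)"
proof (rule inj_onI, rule ccontr)
  fix e f assume h: "e \<in> [I]\<^bsup>2\<^esup>" "f \<in> [I]\<^bsup>2\<^esup>" "c e = c f" "e \<noteq> f"
  then have V: "e \<in> [V]\<^bsup>2\<^esup>" "f \<in> [V]\<^bsup>2\<^esup>" using I(1) by (auto simp: nsets_def)
  then have d: "e \<inter> f = {}" using c h unfolding proper_edge_coloring_def by auto
  then have "card (e \<union> f) = 4" using h by (simp add: nsets_def card_Un_disjoint)
  then have "e \<union> f \<in> clashes V c" using V d h(3) by (auto simp: clashes_def nsets_def)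
  moreover have "e \<union> f \<subseteq> I" using h by (auto simp: nsets_def)
  ultimately show False using I(2) by (auto simp: edge_free_def)
qed

text \<open>The sample size \<open>m = s\<^sup>1\<^sup>3\<close> is chosen between \<open>N\<^sup>1\<^sup>/\<^sup>3\<close> (so that \<open>s \<cdot> |I| / m\<close> is small) and \<open>N\<^sup>3\<^sup>/\<^sup>8\<close> (so that
  few pairs are bad).\<close>

lemma rainbow_clique_exists:
  assumes V: "finite V" "card V = s ^ 35" and s: "s \<ge> 1584"
    and k: "48 * real k ^ 3 \<le> real s ^ 35 * ln (real s)"
    and c: "proper_edge_coloring (V, [V]\<^bsup>2\<^esup>) c"
  shows "\<exists>K\<subseteq>V. card K = k \<and> inj_on c ([K]\<^bsup>2\<^esup>)"
proof (rule ccontr)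
  assume no: "\<not> ?thesis"
  interpret quadruple_system V "clashes V c"
    using quadruple_system_clashes[OF V(1) c] .
  have small: "card I \<le> k" if I: "I \<subseteq> V" "edge_free (clashes V c) I" for I
  proof (rule ccontr)
    assume "\<not> card I \<le> k"
    then obtain K where K: "K \<subseteq> I" "card K = k" using obtain_subset_with_card_n[of k I] by auto
    then have "inj_on c ([K]\<^bsup>2\<^esup>)"
      using clash_free_rainbow[OF c, of K] I edge_free_subset[OF I(2) K(1)] by blast
    then show False using no K I by blast
  qed
  have s0: "real s > 0" using s by simp
  define N p M where "N = real s ^ 35" and "p = real (s ^ 13) / real (s ^ 35)" and "M = real (card V choose s ^ 13)"
  have p: "p = 1 / real s ^ 22" using s0 by (simp add: p_def power_diff[symmetric] field_simps flip: power_add)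
  have le: "s ^ 13 \<le> s ^ 35" using s by (intro power_increasing) auto
  have "2 * s ^ 13 \<le> s * s ^ 13" using s by (intro mult_right_mono) auto
  also have "\<dots> = s ^ 14" by (simp flip: power_Suc)
  also have "\<dots> \<le> s ^ 35" using s by (intro power_increasing) auto
  finally have m2: "2 * s ^ 13 \<le> card V" by (simp add: V)
  have "real (card {(X, v). X \<in> nsets V (s ^ 13) \<and> v \<in> X \<and> \<not> good X v})
    \<le> (216 * N ^ 4 * p ^ 6 + 144 * N ^ 3 * p ^ 5 + 432 * N ^ 6 * p ^ 9) * M"
    using card_bad_pairs_le[of "s ^ 13"] V le s by (simp add: N_def p_def M_def)
  also have "\<dots> \<le> (real s ^ 13 / 2) * M"
  proof (rule mult_right_mono)
    \<comment> \<open>All three powers are at most s^12, and 216 + 144 + 432 = 792 = 1584/2, which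
      is where the lower bound on \<open>s\<close> comes from.\<close>
    have "N ^ 4 * p ^ 6 = real s ^ 8" "N ^ 3 * p ^ 5 = 1 / real s ^ 5" "N ^ 6 * p ^ 9 = real s ^ 12"
      unfolding p N_def using s0 by (simp_all add: power_divide field_simps flip: power_mult power_add)
    moreover have "real s ^ 8 \<le> real s ^ 12" using s by (intro power_increasing) auto
    moreover have "1 / real s ^ 5 \<le> 1" using s by (simp add: field_simps)
    moreover have "1 \<le> real s ^ 12" using s by (simp add: one_le_power)
    moreover have "1584 * real s ^ 12 \<le> real s * real s ^ 12" using s by (intro mult_right_mono) auto
    moreover have "real s * real s ^ 12 = real s ^ 13" by (simp flip: power_Suc)
    ultimately show "216 * N ^ 4 * p ^ 6 + 144 * N ^ 3 * p ^ 5 + 432 * N ^ 6 * p ^ 9 \<le> real s ^ 13 / 2"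
      by (simp add: mult.assoc)
  qed (simp add: M_def)
  finally have bad: "2 * real (card {(X, v). X \<in> nsets V (s ^ 13) \<and> v \<in> X \<and> \<not> good X v}) \<le> real (s ^ 13) * M"
    by simp
  \<comment> \<open>The averaged bound with w = s. Its last term is at most (ln s)/8 by the choice
    of \<open>k\<close> and the other at most 2/3, so ln s \<le> 16/3, contradicting ln s \<ge>
    6.\<close>
  have "ln (real s) / 4 \<le> 2 * real s * real k / real (s ^ 13) + 6 * real k ^ 3 / real (card V)"
    using s m2 small bad by (intro average_bound) (auto simp: M_def)
  moreover have "6 * real k ^ 3 / real (card V) \<le> ln (real s) / 8"
    using k s0 by (simp add: V field_simps)
  moreover have "2 * real s * real k / real (s ^ 13) \<le> 2 / 3"
  proof -
    \<comment> \<open>The crude bound ln s \<le> s turns the right-hand side into a perfect cube and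
      gives 3k \<le> s^12.\<close>
    have "48 * real k ^ 3 \<le> real s ^ 35 * real s"
      using k s0 ln_le_minus_one[OF s0]
      by (elim order_trans) (intro mult_left_mono, auto)
    also have "\<dots> = (real s ^ 12) ^ 3" by (simp flip: power_Suc2 power_mult)
    finally have "48 * real k ^ 3 \<le> (real s ^ 12) ^ 3" .
    moreover have "(3 * real k) ^ 3 = 27 * real k ^ 3" "real k ^ 3 \<ge> 0" by (simp_all add: power_mult_distrib)
    ultimately have "(3 * real k) ^ 3 \<le> (real s ^ 12) ^ 3" by linarith
    then have "3 * real k \<le> real s ^ 12" by (rule power_le_imp_le_base[of _ 2, simplified]) simp
    moreover have "real (s ^ 13) = real s * real s ^ 12" by (simp flip: power_Suc)
    ultimately show ?thesis using s0 by (simp add: field_simps)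
  qed
  moreover have "ln (real s) \<ge> 6"
  proof -
    have "exp (6::real) = exp 1 ^ 6" by (simp flip: exp_of_nat_mult)
    also have "\<dots> \<le> 3 ^ 6" using exp_le by (intro power_mono) auto
    also have "\<dots> \<le> real s" using s by simp
    finally show ?thesis using s0 by (simp add: ln_ge_iff)
  qed
  ultimately show False by linarith
qed

section \<open>The upper bound\<close>

text \<open>The witness is the complete graph on s^35 vertices. The second claim makes the
  \<open>LEAST\<close> in \<open>AR\<^sub>s\<close> attained, which the lower bound relies
  on.\<close>

lemma AR_complete_le:
  assumes "s \<ge> 1584" "48 * real n ^ 3 \<le> real s ^ 35 * ln (real s)"
  shows "real (AR\<^sub>s (complete_graph n)) \<le> (real s ^ 35)\<^sup>2"
    and "\<exists>G :: nat graph. finite_simple_graph G \<and> forces_rainbow G (complete_graph n)"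
proof -
  define G where "G = complete_graph (s ^ 35)"
  have G: "G = ({..<s ^ 35}, [{..<s ^ 35}]\<^bsup>2\<^esup>)" by (simp add: G_def complete_graph_def)
  have fin: "finite_simple_graph G" by (simp add: G finite_simple_graph_def)
  have forces: "forces_rainbow G (complete_graph n)"
    unfolding forces_rainbow_complete_iff
  proof (intro allI impI)
    fix c assume c: "proper_edge_coloring G c"
    obtain K where K: "K \<subseteq> {..<s ^ 35}" "card K = n" "inj_on c ([K]\<^bsup>2\<^esup>)"
      using rainbow_clique_exists[of "{..<s ^ 35}" s n c] assms c by (auto simp: G)
    then show "\<exists>K. K \<subseteq> verts G \<and> finite K \<and> card K = n \<and> [K]\<^bsup>2\<^esup> \<subseteq> edges G \<and> inj_on c ([K]\<^bsup>2\<^esup>)"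
      using finite_subset[OF K(1)] nsets_mono[OF K(1)] by (auto simp: G)
  qed
  show "\<exists>G :: nat graph. finite_simple_graph G \<and> forces_rainbow G (complete_graph n)"
    using fin forces by blast
  have "AR\<^sub>s (complete_graph n) \<le> card (edges G)"
    unfolding AR\<^sub>s_def by (rule Least_le) (use fin forces in blast)
  also have "\<dots> = s ^ 35 choose 2" by (simp add: G card_nsets)
  also have "\<dots> \<le> (s ^ 35)\<^sup>2"
    using assms by (intro binomial_le_pow) (auto intro: order_trans[OF _ self_le_power])
  finally show "real (AR\<^sub>s (complete_graph n)) \<le> (real s ^ 35)\<^sup>2"
    by (metis of_nat_le_iff of_nat_power)
qed

text \<open>The least admissible \<open>s\<close> is taken. Unless it is 1584, the inequality fails
  for t = s - 1, which bounds t^35 ln t by 48 n^3; and n \<le> s^12 \<le> t^24 lets ln n replace ln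
  t up to a constant.\<close>

lemma upper_parameter_exists:
  "\<exists>C>0. \<forall>n\<ge>2. \<exists>s\<ge>1584. 48 * real n ^ 3 \<le> real s ^ 35 * ln (real s)
     \<and> real s ^ 35 \<le> C * real n ^ 3 / ln (real n)"
proof -
  \<comment> \<open>The first summand serves the case s = 1584. In the second, 2^35 comes from s
    \<le> 2t, 48 from the inequality failing at t, and 24 from ln n \<le> 24 ln t.\<close>
  define C where "C = 1584 ^ 35 + 2 ^ 35 * 48 * (24::real)"
  have "\<exists>s\<ge>1584. 48 * real n ^ 3 \<le> real s ^ 35 * ln (real s) \<and> real s ^ 35 \<le> C * real n ^ 3 / ln (real n)"
    if n: "n \<ge> 2" for n :: nat
  proof -
    have lnn: "ln (real n) > 0" "ln (real n) \<le> real n" using n ln_le_minus_one[of "real n"] by auto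
    define P where "P s \<longleftrightarrow> 1584 \<le> s \<and> 48 * real n ^ 3 \<le> real s ^ 35 * ln (real s)" for s :: nat
    have ln1: "ln (real s) \<ge> 1" if "s \<ge> 1584" for s :: nat
    proof -
      have "exp 1 \<le> real s" using exp_le that by linarith
      then show ?thesis using that by (simp add: ln_ge_iff)
    qed
    \<comment> \<open>A wasteful admissible value, which only shows that the least one
      exists.\<close>
    have "P (1584 + 48 * n)"
      unfolding P_def
    proof
      let ?s = "1584 + 48 * n"
      have "48 * real n ^ 3 \<le> (48 * real n) ^ 3" by (simp add: power_mult_distrib)
      also have "\<dots> \<le> real ?s ^ 3" by (intro power_mono) auto
      also have "\<dots> \<le> real ?s ^ 35" by (intro power_increasing) auto
      also have "\<dots> \<le> real ?s ^ 35 * ln (real ?s)" using ln1[of ?s] by (simp add: mult_le_cancel_left1)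
      finally show "48 * real n ^ 3 \<le> real ?s ^ 35 * ln (real ?s)" .
    qed simp
    then have P: "P (LEAST s. P s)" by (rule LeastI)
    define s where "s = (LEAST s. P s)"
    have Ps: "P s" using P by (simp add: s_def)
    have "real s ^ 35 \<le> C * real n ^ 3 / ln (real n)"
    proof (cases "s = 1584")
      case True
      have "real n ^ 1 \<le> real n ^ 3" using n by (intro power_increasing) auto
      then have "ln (real n) \<le> real n ^ 3" using lnn(2) unfolding power_one_right by (rule order_trans[rotated])
      then have "1584 ^ 35 * ln (real n) \<le> 1584 ^ 35 * real n ^ 3" by simp
      also have "\<dots> \<le> C * real n ^ 3" by (intro mult_right_mono) (auto simp: C_def)
      finally show ?thesis using True lnn by (simp add: pos_le_divide_eq)
    next
      case False
      define t where "t = s - 1"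
      have t: "t \<ge> 1584" "s = Suc t" using False Ps by (auto simp: t_def P_def)
      have "\<not> P t" unfolding t_def using t by (intro not_less_Least[of t P, folded s_def, unfolded t_def]) simp
      then have lt: "real t ^ 35 * ln (real t) < 48 * real n ^ 3" using t by (auto simp: P_def)
      have "real n ^ 3 \<le> 48 * real n ^ 3" by simp
      also have "\<dots> \<le> real s ^ 35 * real s"
        using Ps ln_le_minus_one[of "real s"] t unfolding P_def
        by (elim conjE order_trans) (intro mult_left_mono, auto)
      also have "\<dots> = (real s ^ 12) ^ 3" by (simp flip: power_Suc2 power_mult)
      finally have "real n \<le> real s ^ 12" by (rule power_le_imp_le_base[of _ 2, simplified]) simp
      also have "real s \<le> real t ^ 2"
      proof -
        have "2 * real t \<le> real t * real t" using t by (intro mult_right_mono) auto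
        moreover have "real s = real t + 1" "real t \<ge> 1" using t by auto
        ultimately show ?thesis unfolding power2_eq_square by linarith
      qed
      then have "real s ^ 12 \<le> (real t ^ 2) ^ 12" by (intro power_mono) auto
      also have "\<dots> = real t ^ 24" by (simp flip: power_mult)
      finally have "ln (real n) \<le> ln (real t ^ 24)" using n t by simp
      also have "\<dots> = 24 * ln (real t)" using t by (simp add: ln_realpow)
      finally have lnt: "ln (real n) \<le> 24 * ln (real t)" .
      have "real s ^ 35 * ln (real n) \<le> (2 * real t) ^ 35 * (24 * ln (real t))"
        using lnt lnn t by (intro mult_mono power_mono) auto
      also have "\<dots> = (2 ^ 35 * 24) * (real t ^ 35 * ln (real t))" by (simp add: power_mult_distrib)
      also have "\<dots> \<le> (2 ^ 35 * 24) * (48 * real n ^ 3)" using lt by (intro mult_left_mono) auto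
      also have "\<dots> \<le> C * real n ^ 3" by (simp add: C_def algebra_simps)
      finally show ?thesis using lnn by (simp add: pos_le_divide_eq)
    qed
    then show ?thesis using Ps by (auto simp: P_def)
  qed
  moreover have "C > 0" by (simp add: C_def)
  ultimately show ?thesis by blast
qed

lemma AR_complete_upper:
  "\<exists>C>0. \<forall>n\<ge>2. real (AR\<^sub>s (complete_graph n)) \<le> C * real n ^ 6 / (ln (real n))\<^sup>2"
proof -
  obtain C where C: "C > 0" "\<forall>n\<ge>2. \<exists>s\<ge>1584. 48 * real n ^ 3 \<le> real s ^ 35 * ln (real s)
     \<and> real s ^ 35 \<le> C * real n ^ 3 / ln (real n)"
    using upper_parameter_exists by blast
  have "real (AR\<^sub>s (complete_graph n)) \<le> C\<^sup>2 * real n ^ 6 / (ln (real n))\<^sup>2" if n: "n \<ge> 2" for n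
  proof -
    obtain s where s: "s \<ge> 1584" "48 * real n ^ 3 \<le> real s ^ 35 * ln (real s)"
      "real s ^ 35 \<le> C * real n ^ 3 / ln (real n)"
      using C(2) n by blast
    have "real (AR\<^sub>s (complete_graph n)) \<le> (real s ^ 35)\<^sup>2" using AR_complete_le(1)[OF s(1,2)] .
    also have "\<dots> \<le> (C * real n ^ 3 / ln (real n))\<^sup>2" using s(3) by (intro power_mono) auto
    finally show ?thesis by (simp add: power_divide power_mult_distrib flip: power_mult)
  qed
  then show ?thesis using C(1) by (intro exI[of _ "C\<^sup>2"]) auto
qed

section \<open>Averages over random edge maps\<close>

text \<open>The average of \<open>F\<close> over uniformly random values below \<open>Q\<close> at the positions \<open>es\<close>, the other values being
  those of \<open>\<phi>\<close>.\<close>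

fun avg :: "nat \<Rightarrow> 'e list \<Rightarrow> (('e \<Rightarrow> nat) \<Rightarrow> real) \<Rightarrow> ('e \<Rightarrow> nat) \<Rightarrow> real" where
  "avg Q [] F \<phi> = F \<phi>"
| "avg Q (e # es) F \<phi> = (\<Sum>c<Q. avg Q es F (\<phi>(e := c))) / real Q"

lemma avg_append: "avg Q (xs @ ys) F \<phi> = avg Q xs (avg Q ys F) \<phi>"
  by (induction xs arbitrary: \<phi>) auto

text \<open>Restricting the comparison to maps that agree with \<open>\<phi>\<close> off
  \<open>es\<close> allows values fixed earlier to be used inside a later average.\<close>

lemma avg_mono:
  assumes "\<And>\<psi>. (\<And>e. e \<notin> set es \<Longrightarrow> \<psi> e = \<phi> e) \<Longrightarrow> F \<psi> \<le> G \<psi>"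
  shows "avg Q es F \<phi> \<le> avg Q es G \<phi>"
  using assms
proof (induction es arbitrary: \<phi>)
  case (Cons e es)
  have "avg Q es F (\<phi>(e := c)) \<le> avg Q es G (\<phi>(e := c))" for c
    by (rule Cons.IH, rule Cons.prems) auto
  then show ?case by (auto intro!: divide_right_mono sum_mono)
qed auto

lemma avg_const: "Q > 0 \<Longrightarrow> avg Q es (\<lambda>_. a) \<phi> = a"
  by (induction es arbitrary: \<phi>) auto

lemma avg_add: "avg Q es (\<lambda>\<psi>. F \<psi> + G \<psi>) \<phi> = avg Q es F \<phi> + avg Q es G \<phi>"
  by (induction es arbitrary: \<phi>) (auto simp: sum.distrib add_divide_distrib)

lemma avg_cmult: "avg Q es (\<lambda>\<psi>. a * F \<psi>) \<phi> = a * avg Q es F \<phi>"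
  by (induction es arbitrary: \<phi>) (auto simp: sum_distrib_left)

lemma avg_sum: "avg Q es (\<lambda>\<psi>. \<Sum>i\<in>I. F i \<psi>) \<phi> = (\<Sum>i\<in>I. avg Q es (F i) \<phi>)"
proof (induction es arbitrary: \<phi>)
  case (Cons e es)
  show ?case unfolding avg.simps Cons.IH sum_divide_distrib by (rule sum.swap)
qed auto

lemma avg_move:
  assumes "e \<notin> set xs"
  shows "avg Q (xs @ e # ys) F \<phi> = avg Q (e # xs @ ys) F \<phi>"
  using assms
proof (induction xs arbitrary: \<phi>)
  case (Cons x xs)
  have "avg Q ((x # xs) @ e # ys) F \<phi>
    = (\<Sum>c<Q. \<Sum>d<Q. avg Q (xs @ ys) F (\<phi>(x := c, e := d))) / real Q / real Q"
    using Cons by (simp add: sum_divide_distrib)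
  also have "\<dots> = (\<Sum>d<Q. \<Sum>c<Q. avg Q (xs @ ys) F (\<phi>(e := d, x := c))) / real Q / real Q"
  proof -
    have "\<phi>(x := c, e := d) = \<phi>(e := d, x := c)" for c d
      using Cons.prems by (intro fun_upd_twist) auto
    then show ?thesis by (subst sum.swap) simp
  qed
  also have "\<dots> = avg Q (e # (x # xs) @ ys) F \<phi>"
    by (simp add: sum_divide_distrib)
  finally show ?case .
qed simp

text \<open>A finite Fubini theorem: random values may be exposed in any order.\<close>

lemma avg_permute:
  assumes "distinct xs" "distinct ys" "set xs = set ys"
  shows "avg Q xs F \<phi> = avg Q ys F \<phi>"
  using assms
proof (induction xs arbitrary: ys \<phi>)
  case (Cons e xs)
  obtain us vs where ys: "ys = us @ e # vs" using Cons.prems by (metis list.set_intros(1) split_list)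
  have "avg Q xs F \<psi> = avg Q (us @ vs) F \<psi>" for \<psi>
    by (rule Cons.IH) (use Cons.prems ys in auto)
  moreover have "avg Q ys F \<phi> = avg Q (e # us @ vs) F \<phi>"
    unfolding ys using Cons.prems ys by (intro avg_move) auto
  ultimately show ?case by simp
qed simp

lemma exists_less_avg:
  assumes "Q > 0" "avg Q es F \<phi> < b"
  shows "\<exists>\<psi>. F \<psi> < b"
proof (rule ccontr)
  assume "\<not> ?thesis"
  then have "avg Q es (\<lambda>_. b) \<phi> \<le> avg Q es F \<phi>" by (intro avg_mono) (auto simp: not_less)
  then show False using assms by (simp add: avg_const)
qed

text \<open>An exponential moment of the number of different hits, exposing one value at a time;
  \<open>X\<close> holds the hits so far. It never has more than \<open>l\<close> elements, so
  \<open>T e\<close> always offers \<open>h\<close> new values, and a new one halves the weight: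
  each step gains a factor of at most 1 - h/(2Q).\<close>

lemma avg_card_hits:
  assumes "distinct es" "Q > 0" "finite X" "card X + length es \<le> l"
    and T: "\<And>e. e \<in> set es \<Longrightarrow> T e \<subseteq> {..<Q} \<and> h + l \<le> card (T e)"
  shows "avg Q es (\<lambda>\<psi>. (1/2) ^ card (X \<union> {\<psi> e | e. e \<in> set es \<and> \<psi> e \<in> T e})) \<phi>
    \<le> (1/2) ^ card X * (1 - real h / (2 * real Q)) ^ length es"
  using assms
proof (induction es arbitrary: X \<phi>)
  case (Cons e es)
  define r where "r = 1 - real h / (2 * real Q)"
  have Te: "T e \<subseteq> {..<Q}" "h + l \<le> card (T e)" using Cons.prems(5)[of e] by auto
  have "h \<le> Q" using card_mono[OF _ Te(1)] Te(2) by simp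
  then have r: "r \<ge> 0" using Cons.prems(2) by (simp add: r_def field_simps)
  define Y where "Y c = (if c \<in> T e then insert c X else X)" for c
  have step: "avg Q es (\<lambda>\<psi>. (1/2) ^ card (X \<union> {\<psi> e' | e'. e' \<in> set (e # es) \<and> \<psi> e' \<in> T e'})) (\<phi>(e := c))
      \<le> (1/2) ^ card (Y c) * r ^ length es" for c
  proof -
    have "avg Q es (\<lambda>\<psi>. (1/2) ^ card (X \<union> {\<psi> e' | e'. e' \<in> set (e # es) \<and> \<psi> e' \<in> T e'})) (\<phi>(e := c))
      \<le> avg Q es (\<lambda>\<psi>. (1/2) ^ card (Y c \<union> {\<psi> e' | e'. e' \<in> set es \<and> \<psi> e' \<in> T e'})) (\<phi>(e := c))"
    proof (rule avg_mono)
      fix \<psi> assume agree: "\<And>e'. e' \<notin> set es \<Longrightarrow> \<psi> e' = (\<phi>(e := c)) e'"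
      then have "\<psi> e = c" using Cons.prems(1) agree[of e] by simp
      then have "X \<union> {\<psi> e' | e'. e' \<in> set (e # es) \<and> \<psi> e' \<in> T e'} = Y c \<union> {\<psi> e' | e'. e' \<in> set es \<and> \<psi> e' \<in> T e'}"
        by (auto simp: Y_def)
      then show "(1/2::real) ^ card (X \<union> {\<psi> e' | e'. e' \<in> set (e # es) \<and> \<psi> e' \<in> T e'})
        \<le> (1/2) ^ card (Y c \<union> {\<psi> e' | e'. e' \<in> set es \<and> \<psi> e' \<in> T e'})" by simp
    qed
    also have "\<dots> \<le> (1/2) ^ card (Y c) * r ^ length es"
      unfolding r_def
    proof (rule Cons.IH)
      show "card (Y c) + length es \<le> l"
        using Cons.prems(4) card_insert_le_m1[of "Suc (card X)" X c] Cons.prems(3)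
        by (auto simp: Y_def card_insert_if)
    qed (use Cons.prems in \<open>auto simp: Y_def\<close>)
    finally show ?thesis .
  qed
  have "avg Q (e # es) (\<lambda>\<psi>. (1/2) ^ card (X \<union> {\<psi> e' | e'. e' \<in> set (e # es) \<and> \<psi> e' \<in> T e'})) \<phi>
    \<le> (\<Sum>c<Q. (1/2) ^ card (Y c) * r ^ length es) / real Q"
    unfolding avg.simps by (intro divide_right_mono sum_mono step) simp
  also have "\<dots> = (\<Sum>c<Q. (1/2) ^ card (Y c)) / real Q * r ^ length es"
    by (simp add: sum_distrib_right)
  also have "\<dots> \<le> ((1/2) ^ card X * r) * r ^ length es"
  proof (rule mult_right_mono)
    have "h + card X \<le> card (T e)" using Te(2) Cons.prems(4) by simp
    then have hT: "h \<le> card (T e - X)" using diff_card_le_card_Diff[of X "T e"] Cons.prems(3) by linarith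
    have fin: "finite (T e)" using Te(1) finite_subset by blast
    have "(\<Sum>c<Q. (1/2::real) ^ card (Y c)) = (\<Sum>c<Q. (1/2) ^ card X * (1 - (if c \<in> T e - X then 1/2 else 0)))"
      using Cons.prems(3) by (intro sum.cong) (auto simp: Y_def insert_absorb)
    also have "\<dots> = (1/2) ^ card X * (real Q - (\<Sum>c<Q. if c \<in> T e - X then 1/2 else 0))"
      by (simp add: sum_distrib_left[symmetric] sum_subtractf)
    also have "(\<Sum>c<Q. if c \<in> T e - X then 1/2 else 0 :: real) = real (card (T e - X)) / 2"
    proof -
      have "{..<Q} \<inter> {c. c \<in> T e - X} = T e - X" using Te(1) by auto
      then show ?thesis by (simp add: sum.If_cases del: Diff_iff)
    qed
    also have "(1/2) ^ card X * (real Q - real (card (T e - X)) / 2) \<le> (1/2) ^ card X * (real Q - real h / 2)"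
      using hT by (intro mult_left_mono) auto
    finally show "(\<Sum>c<Q. (1/2::real) ^ card (Y c)) / real Q \<le> (1/2) ^ card X * r"
      using Cons.prems(2) by (simp add: r_def field_simps)
  qed (use r in simp)
  finally show ?case by (simp add: r_def mult.assoc)
qed simp

lemma avg_all_miss:
  assumes "distinct es" "Q > 0"
    and T: "\<And>e. e \<in> set es \<Longrightarrow> T e \<subseteq> {..<Q} \<and> h \<le> card (T e)"
  shows "avg Q es (\<lambda>\<psi>. of_bool (\<forall>e\<in>set es. \<psi> e \<notin> T e)) \<phi> \<le> (1 - real h / real Q) ^ length es"
  using assms
proof (induction es arbitrary: \<phi>)
  case (Cons e es)
  define r where "r = 1 - real h / real Q"
  have Te: "T e \<subseteq> {..<Q}" "h \<le> card (T e)" using Cons.prems(3)[of e] by auto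
  have "h \<le> Q" using card_mono[OF _ Te(1)] Te(2) by simp
  then have r: "r \<ge> 0" using Cons.prems(2) by (simp add: r_def field_simps)
  have step: "avg Q es (\<lambda>\<psi>. of_bool (\<forall>e'\<in>set (e # es). \<psi> e' \<notin> T e')) (\<phi>(e := c))
      \<le> of_bool (c \<notin> T e) * r ^ length es" for c
  proof -
    have "avg Q es (\<lambda>\<psi>. of_bool (\<forall>e'\<in>set (e # es). \<psi> e' \<notin> T e')) (\<phi>(e := c))
      \<le> avg Q es (\<lambda>\<psi>. of_bool (c \<notin> T e) * of_bool (\<forall>e'\<in>set es. \<psi> e' \<notin> T e')) (\<phi>(e := c))"
    proof (rule avg_mono)
      fix \<psi> assume agree: "\<And>e'. e' \<notin> set es \<Longrightarrow> \<psi> e' = (\<phi>(e := c)) e'"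
      then have "\<psi> e = c" using Cons.prems(1) agree[of e] by simp
      then show "(of_bool (\<forall>e'\<in>set (e # es). \<psi> e' \<notin> T e') :: real)
        \<le> of_bool (c \<notin> T e) * of_bool (\<forall>e'\<in>set es. \<psi> e' \<notin> T e')" by auto
    qed
    also have "\<dots> \<le> of_bool (c \<notin> T e) * r ^ length es"
      unfolding avg_cmult r_def using Cons.prems by (intro mult_left_mono Cons.IH) auto
    finally show ?thesis .
  qed
  have "avg Q (e # es) (\<lambda>\<psi>. of_bool (\<forall>e'\<in>set (e # es). \<psi> e' \<notin> T e')) \<phi>
    \<le> (\<Sum>c<Q. of_bool (c \<notin> T e) * r ^ length es) / real Q"
    unfolding avg.simps by (intro divide_right_mono sum_mono step) simp
  also have "\<dots> = real (card ({..<Q} - T e)) / real Q * r ^ length es"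
    by (simp add: of_bool_def sum_distrib_right[symmetric] sum.If_cases Diff_eq Int_def)
  also have "\<dots> \<le> r * r ^ length es"
  proof (rule mult_right_mono)
    have "card ({..<Q} - T e) = Q - card (T e)"
      using Te(1) finite_subset by (subst card_Diff_subset) auto
    then have "real (card ({..<Q} - T e)) \<le> real Q - real h"
      using Te card_mono[OF _ Te(1)] by (simp add: of_nat_diff)
    then show "real (card ({..<Q} - T e)) / real Q \<le> r"
      using Cons.prems(2) by (simp add: r_def field_simps)
  qed (use r in simp)
  finally show ?case by (simp add: r_def)
qed simp

lemma avg_le_1: "Q > 0 \<Longrightarrow> avg Q es (\<lambda>\<psi>. of_bool (P \<psi>)) \<phi> \<le> 1"
  using avg_mono[of es \<phi> "\<lambda>\<psi>. of_bool (P \<psi>)" "\<lambda>_. 1" Q] avg_const[of Q es 1 \<phi>] by simp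

section \<open>Free colors and the union bound over pairs of vertex sets\<close>

definition free_colors :: "nat \<Rightarrow> 'a set set \<Rightarrow> ('a set \<Rightarrow> nat) \<Rightarrow> 'a set \<Rightarrow> nat set" where
  "free_colors Q R \<phi> e = {c. c < Q \<and> (\<forall>e'\<in>R. e' \<inter> e \<noteq> {} \<longrightarrow> \<phi> e' \<noteq> c)}"

text \<open>The bad event. A color of an edge inside \<open>A\<close> that is free (does not occur on an adjacent edge of \<open>R\<close>)
  survives on some edge inside \<open>A\<close> when each color class is cut down to a maximal matching; hence a free color
  shared by \<open>A\<close> and \<open>B\<close> prevents \<open>A \<union> B\<close> from being rainbow.\<close>

definition no_shared_free_color ::
  "nat \<Rightarrow> 'a set \<Rightarrow> 'a set \<Rightarrow> 'a set \<Rightarrow> ('a set \<Rightarrow> nat) \<Rightarrow> bool" where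
  "no_shared_free_color Q V A B \<phi> \<longleftrightarrow>
    (\<forall>e\<in>[A]\<^bsup>2\<^esup>. \<forall>f\<in>[B]\<^bsup>2\<^esup>. \<not> (\<phi> e = \<phi> f \<and>
      \<phi> e \<in> free_colors Q ([V]\<^bsup>2\<^esup> - [A]\<^bsup>2\<^esup> - [B]\<^bsup>2\<^esup>) \<phi> e \<inter>
             free_colors Q ([V]\<^bsup>2\<^esup> - [A]\<^bsup>2\<^esup> - [B]\<^bsup>2\<^esup>) \<phi> f))"

lemma free_colors_cong:
  "(\<And>e. e \<in> R \<Longrightarrow> \<phi> e = \<psi> e) \<Longrightarrow> free_colors Q R \<phi> = free_colors Q R \<psi>"
  by (auto simp: free_colors_def fun_eq_iff)

lemma card_adjacent_le:
  assumes "finite V" "e \<in> [V]\<^bsup>2\<^esup>"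
  shows "card {e' \<in> [V]\<^bsup>2\<^esup>. e' \<inter> e \<noteq> {}} \<le> 2 * card V"
proof -
  obtain x y where e: "e = {x, y}" using assms by (auto simp: nsets_def card_2_iff)
  have "{e' \<in> [V]\<^bsup>2\<^esup>. e' \<inter> e \<noteq> {}} \<subseteq> (\<lambda>z. {x, z}) ` V \<union> (\<lambda>z. {y, z}) ` V"
    by (auto simp: e nsets_def card_2_iff)
  then have "card {e' \<in> [V]\<^bsup>2\<^esup>. e' \<inter> e \<noteq> {}} \<le> card ((\<lambda>z. {x, z}) ` V \<union> (\<lambda>z. {y, z}) ` V)"
    using assms by (intro card_mono) auto
  also have "\<dots> \<le> card V + card V"
    using assms by (intro order_trans[OF card_Un_le] add_mono card_image_le) auto
  finally show ?thesis by simp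
qed

lemma card_blocked_colors_le:
  assumes "finite V" "e \<in> [V]\<^bsup>2\<^esup>" "R \<subseteq> [V]\<^bsup>2\<^esup>"
  shows "card ({..<Q} - free_colors Q R \<phi> e) \<le> 2 * card V"
proof -
  have fin: "finite ([V]\<^bsup>2\<^esup>)" using assms finite_imp_finite_nsets by blast
  have "{..<Q} - free_colors Q R \<phi> e \<subseteq> \<phi> ` {e' \<in> [V]\<^bsup>2\<^esup>. e' \<inter> e \<noteq> {}}"
    using assms(3) by (auto simp: free_colors_def)
  then have "card ({..<Q} - free_colors Q R \<phi> e) \<le> card (\<phi> ` {e' \<in> [V]\<^bsup>2\<^esup>. e' \<inter> e \<noteq> {}})"
    using fin by (intro card_mono) auto
  also have "\<dots> \<le> card {e' \<in> [V]\<^bsup>2\<^esup>. e' \<inter> e \<noteq> {}}" using fin by (intro card_image_le) auto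
  also have "\<dots> \<le> 2 * card V" by (rule card_adjacent_le[OF assms(1,2)])
  finally show ?thesis .
qed

text \<open>The colors outside \<open>A\<close> and \<open>B\<close> are exposed first, which fixes
  the free colors, then those inside \<open>A\<close>, then those inside \<open>B\<close>. The first
  term bounds the probability that for some edge \<open>f\<close> inside \<open>B\<close> fewer than
  \<open>u\<close> suitable colors occur inside \<open>A\<close>; the second, the probability that
  otherwise every edge inside \<open>B\<close> misses its suitable colors.\<close>

lemma avg_no_shared_free_color_le:
  fixes V A B :: "'a set"
  assumes V: "finite V" "V \<noteq> {}" and sub: "A \<subseteq> V" "B \<subseteq> V" "A \<inter> B = {}"
    and card: "card A = a" "card B = a" and M: "M = a choose 2" "M \<le> 2 * card V"
    and es: "distinct es" "set es = [V]\<^bsup>2\<^esup>" and u: "16 * u \<le> M"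
  defines "Q \<equiv> 8 * card V"
  shows "avg Q es (\<lambda>\<phi>. of_bool (no_shared_free_color Q V A B \<phi>)) \<phi>\<^sub>0
    \<le> real M * (1/4) ^ u + (1 - real u / real Q) ^ M"
proof -
  have Q: "Q > 0" using V by (simp add: Q_def card_gt_0_iff)
  define EA EB R where "EA = [A]\<^bsup>2\<^esup>" and "EB = [B]\<^bsup>2\<^esup>" and "R = [V]\<^bsup>2\<^esup> - [A]\<^bsup>2\<^esup> - [B]\<^bsup>2\<^esup>"
  have finV: "finite ([V]\<^bsup>2\<^esup>)" using V finite_imp_finite_nsets by blast
  have EAB: "EA \<subseteq> [V]\<^bsup>2\<^esup>" "EB \<subseteq> [V]\<^bsup>2\<^esup>"
    unfolding EA_def EB_def using sub nsets_mono by blast+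
  have fAB: "finite A" "finite B" using finite_subset[OF _ V(1)] sub by blast+
  have disj: "EA \<inter> EB = {}" "EA \<inter> R = {}" "EB \<inter> R = {}"
  proof -
    have "e \<notin> EB" if "e \<in> EA" for e
    proof
      assume "e \<in> EB"
      then have "e \<subseteq> A \<inter> B" "card e = 2" using that by (auto simp: EA_def EB_def nsets_def)
      then show False using sub by simp
    qed
    then show "EA \<inter> EB = {}" by blast
  qed (auto simp: EA_def EB_def R_def)
  have cardE: "card EA = M" "card EB = M" by (simp_all add: EA_def EB_def card_nsets card M)
  obtain as bs rs where l: "set as = EA" "distinct as" "set bs = EB" "distinct bs" "set rs = R" "distinct rs"
    using finite_distinct_list finite_subset[OF EAB(1) finV] finite_subset[OF EAB(2) finV] finV
    by (metis R_def finite_Diff)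
  have len: "length as = M" "length bs = M" using l cardE by (metis distinct_card)+
  define F where "F \<phi> = (of_bool (no_shared_free_color Q V A B \<phi>) :: real)" for \<phi>
  define bnd where "bnd = real M * (1/4) ^ u + (1 - real u / real Q) ^ M"
  have perm: "avg Q es F \<phi>\<^sub>0 = avg Q (rs @ as @ bs) F \<phi>\<^sub>0"
  proof (rule avg_permute)
    show "distinct (rs @ as @ bs)" using l disj by auto
    show "set es = set (rs @ as @ bs)" using l es EAB by (auto simp: R_def EA_def EB_def)
  qed (rule es)
  have inner: "avg Q (as @ bs) F \<phi> \<le> bnd" for \<phi>
  proof -
    define G where "G = free_colors Q R \<phi>"
    have G_sub: "G e \<subseteq> {..<Q}" for e by (auto simp: G_def free_colors_def)
    define T where "T f e = G e \<inter> G f" for f e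
    \<comment> \<open>The colors occurring inside \<open>A\<close> that are free both for their edge
      and for \<open>f\<close>. The empty set is the initial hit set of
      \<open>avg_card_hits\<close>.\<close>
    define U where "U f \<psi> = {} \<union> {\<psi> e | e. e \<in> set as \<and> \<psi> e \<in> T f e}" for f and \<psi> :: "'a set \<Rightarrow> nat"
    \<comment> \<open>Each of the two edges blocks at most 2|V| of the 8|V| colors. Of the remaining
      4|V|, half serve as \<open>h\<close> and half as the cap \<open>l\<close> on the number of
      hits.\<close>
    have T_card: "2 * card V + 2 * card V \<le> card (T f e)" if "e \<in> EA" "f \<in> EB" for e f
    proof -
      have "card ({..<Q} - T f e) \<le> card (({..<Q} - G e) \<union> ({..<Q} - G f))"
        by (intro card_mono) (auto simp: T_def)
      also have "\<dots> \<le> 2 * card V + 2 * card V"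
        unfolding G_def using that EAB V
        by (intro order_trans[OF card_Un_le] add_mono card_blocked_colors_le) (auto simp: R_def)
      finally have "card ({..<Q} - T f e) \<le> 4 * card V" by simp
      moreover have "card ({..<Q} - T f e) = Q - card (T f e)"
        using G_sub finite_subset[of "T f e" "{..<Q}"] by (subst card_Diff_subset) (auto simp: T_def)
      ultimately show ?thesis by (simp add: Q_def)
    qed
    have A_part: "avg Q as (\<lambda>\<psi>. of_bool (card (U f \<psi>) < u)) \<phi> \<le> (1/4) ^ u" if f: "f \<in> EB" for f
    proof -
      \<comment> \<open>Markov's inequality for (1/2)^|U|. The decay factor below is 1 -
        2|V|/(16|V|) = 7/8, and 16 factors per unit of \<open>u\<close> bring 2 (7/8)^16 below
        1/4.\<close>
      have "avg Q as (\<lambda>\<psi>. of_bool (card (U f \<psi>) < u)) \<phi> \<le> avg Q as (\<lambda>\<psi>. 2 ^ u * (1/2) ^ card (U f \<psi>)) \<phi>"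
      proof (rule avg_mono)
        fix \<psi> :: "'a set \<Rightarrow> nat"
        have "(1/2::real) ^ u \<le> (1/2) ^ card (U f \<psi>)" if "card (U f \<psi>) < u"
          using that by (intro power_decreasing) auto
        then show "of_bool (card (U f \<psi>) < u) \<le> (2 ^ u * (1/2) ^ card (U f \<psi>) :: real)"
          by (auto simp: power_one_over field_simps)
      qed
      also have "\<dots> \<le> 2 ^ u * ((1/2) ^ card ({} :: nat set) * (1 - real (2 * card V) / (2 * real Q)) ^ length as)"
        unfolding avg_cmult U_def
      proof (intro mult_left_mono avg_card_hits)
        show "card {} + length as \<le> 2 * card V" using len M by simp
        show "T f e \<subseteq> {..<Q} \<and> 2 * card V + 2 * card V \<le> card (T f e)" if "e \<in> set as" for e
          using T_card[of e f] that f l G_sub by (auto simp: T_def)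
      qed (use l Q in auto)
      also have "\<dots> = 2 ^ u * (7/8) ^ M" using V by (simp add: len Q_def card_gt_0_iff)
      also have "\<dots> \<le> 2 ^ u * (7/8) ^ (16 * u)" using u by (intro mult_left_mono power_decreasing) auto
      also have "\<dots> = (2 * (7/8) ^ 16) ^ u" by (simp add: power_mult power_mult_distrib)
      also have "\<dots> \<le> (1/4) ^ u" by (intro power_mono) (simp_all add: power_divide)
      finally show ?thesis .
    qed
    \<comment> \<open>If some \<open>f\<close> has too few suitable colors, the sum is at least 1
      and the bound is trivial.\<close>
    have B_part: "avg Q bs F \<psi> \<le> (\<Sum>f\<in>EB. of_bool (card (U f \<psi>) < u)) + (1 - real u / real Q) ^ M"
      if agree: "\<And>e. e \<notin> set as \<Longrightarrow> \<psi> e = \<phi> e" for \<psi>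
    proof (cases "\<exists>f\<in>EB. card (U f \<psi>) < u")
      case True
      have "finite EB" using EAB finV finite_subset by blast
      have uQ: "u \<le> Q" using u M by (simp add: Q_def)
      have "avg Q bs F \<psi> \<le> 1" unfolding F_def using Q by (rule avg_le_1)
      also have "1 \<le> (\<Sum>f\<in>EB. of_bool (card (U f \<psi>) < u) :: real)"
      proof -
        obtain f where f: "f \<in> EB" "card (U f \<psi>) < u" using True by blast
        have "(\<Sum>f\<in>{f}. of_bool (card (U f \<psi>) < u) :: real) \<le> (\<Sum>f\<in>EB. of_bool (card (U f \<psi>) < u))"
          using f \<open>finite EB\<close> by (intro sum_mono2) auto
        then show ?thesis using f by simp
      qed
      finally show ?thesis using uQ Q by (intro order_trans[OF _ add_increasing2]) auto
    next
      case False
      have "avg Q bs F \<psi> \<le> avg Q bs (\<lambda>\<chi>. of_bool (\<forall>f\<in>set bs. \<chi> f \<notin> U f \<psi>)) \<psi>"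
      proof (rule avg_mono)
        fix \<chi> assume agree': "\<And>e. e \<notin> set bs \<Longrightarrow> \<chi> e = \<psi> e"
        have "free_colors Q R \<chi> = G"
          unfolding G_def
        proof (rule free_colors_cong)
          fix e assume "e \<in> R"
          then show "\<chi> e = \<phi> e" using agree agree' disj l by (metis disjoint_iff)
        qed
        note G = this
        have "\<chi> f \<notin> U f \<psi>" if ns: "no_shared_free_color Q V A B \<chi>" and f: "f \<in> EB" for f
        proof
          assume "\<chi> f \<in> U f \<psi>"
          then obtain e where e: "e \<in> EA" "\<chi> f = \<psi> e" "\<psi> e \<in> G e \<inter> G f"
            using l by (auto simp: U_def T_def)
          have "\<chi> e = \<psi> e" using agree' disj l e by (metis disjoint_iff)
          moreover have "\<not> (\<chi> e = \<chi> f \<and> \<chi> e \<in> G e \<inter> G f)"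
            using ns e(1) f unfolding no_shared_free_color_def G[symmetric] R_def EA_def EB_def by blast
          ultimately show False using e by simp
        qed
        then show "F \<chi> \<le> of_bool (\<forall>f\<in>set bs. \<chi> f \<notin> U f \<psi>)" using l by (simp add: F_def)
      qed
      also have "\<dots> \<le> (1 - real u / real Q) ^ length bs"
      proof (rule avg_all_miss)
        fix f assume "f \<in> set bs"
        moreover have "U f \<psi> \<subseteq> {..<Q}" using G_sub by (auto simp: U_def T_def)
        ultimately show "U f \<psi> \<subseteq> {..<Q} \<and> u \<le> card (U f \<psi>)" using False l by (auto simp: not_less)
      qed (use l Q in auto)
      finally have "avg Q bs F \<psi> \<le> (1 - real u / real Q) ^ M" using len by simp
      then show ?thesis by (intro add_increasing) (auto intro!: sum_nonneg)
    qed
    have "avg Q (as @ bs) F \<phi> \<le> avg Q as (\<lambda>\<psi>. (\<Sum>f\<in>EB. of_bool (card (U f \<psi>) < u)) + (1 - real u / real Q) ^ M) \<phi>"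
      unfolding avg_append by (rule avg_mono) (rule B_part)
    also have "\<dots> = (\<Sum>f\<in>EB. avg Q as (\<lambda>\<psi>. of_bool (card (U f \<psi>) < u)) \<phi>) + (1 - real u / real Q) ^ M"
      by (simp add: avg_add avg_sum avg_const Q)
    also have "\<dots> \<le> of_nat (card EB) * (1/4) ^ u + (1 - real u / real Q) ^ M"
      by (intro add_right_mono sum_bounded_above A_part)
    finally show ?thesis by (simp add: bnd_def cardE)
  qed
  have "avg Q es F \<phi>\<^sub>0 \<le> avg Q rs (\<lambda>_. bnd) \<phi>\<^sub>0"
    unfolding perm avg_append[of Q rs] by (rule avg_mono) (rule inner)
  then show ?thesis unfolding F_def bnd_def by (simp add: avg_const Q)
qed

text \<open>Union bound: there are at most |V|^(2a) pairs of sets, so the expected number of bad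
  ones is below 1 and some map has none.\<close>

lemma exists_edge_map_all_shared:
  fixes V :: "'a set"
  assumes V: "finite V" "V \<noteq> {}" and M: "M = a choose 2" "M \<le> 2 * card V" and u: "16 * u \<le> M"
    and small: "real (card V) ^ (2 * a) * (real M * (1/4) ^ u + (1 - real u / real (8 * card V)) ^ M) < 1"
  shows "\<exists>\<phi>. \<forall>A B. A \<subseteq> V \<and> B \<subseteq> V \<and> A \<inter> B = {} \<and> card A = a \<and> card B = a
    \<longrightarrow> \<not> no_shared_free_color (8 * card V) V A B \<phi>"
proof -
  define Q where "Q = 8 * card V"
  have Q: "Q > 0" using V by (simp add: Q_def card_gt_0_iff)
  obtain es where es: "distinct es" "set es = [V]\<^bsup>2\<^esup>"
    using finite_distinct_list finite_imp_finite_nsets[OF V(1)] by metis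
  define P where "P = {(A, B). A \<subseteq> V \<and> B \<subseteq> V \<and> A \<inter> B = {} \<and> card A = a \<and> card B = a}"
  define b where "b = real M * (1/4) ^ u + (1 - real u / real Q) ^ M"
  have "u \<le> Q" using u M by (simp add: Q_def)
  then have b: "b \<ge> 0" using Q by (auto simp: b_def)
  have P_sub: "P \<subseteq> [V]\<^bsup>a\<^esup> \<times> [V]\<^bsup>a\<^esup>"
    using V(1) finite_subset by (auto simp: P_def nsets_def)
  have finP: "finite P" using P_sub V finite_imp_finite_nsets by (metis finite_cartesian_product finite_subset)
  have "card P \<le> card ([V]\<^bsup>a\<^esup> \<times> [V]\<^bsup>a\<^esup>)"
    using P_sub V finite_imp_finite_nsets by (intro card_mono) auto
  also have "\<dots> = (card V choose a) * (card V choose a)" by (simp add: card_cartesian_product card_nsets)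
  also have "\<dots> \<le> card V ^ a * card V ^ a"
  proof -
    have "card V choose a \<le> card V ^ a"
      by (cases "a \<le> card V") (auto intro: binomial_le_pow simp: binomial_eq_0)
    then show ?thesis by (intro mult_le_mono)
  qed
  also have "\<dots> = card V ^ (2 * a)" by (simp add: mult_2 power_add)
  finally have "real (card P) \<le> real (card V ^ (2 * a))" by (simp only: of_nat_le_iff)
  then have cardP: "real (card P) \<le> real (card V) ^ (2 * a)" by simp
  have "avg Q es (\<lambda>\<phi>. \<Sum>(A, B)\<in>P. of_bool (no_shared_free_color Q V A B \<phi>)) (\<lambda>_. 0)
    = (\<Sum>(A, B)\<in>P. avg Q es (\<lambda>\<phi>. of_bool (no_shared_free_color Q V A B \<phi>)) (\<lambda>_. 0))"
    by (simp add: case_prod_unfold avg_sum)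
  also have "\<dots> \<le> of_nat (card P) * b"
  proof (rule sum_bounded_above)
    fix p assume p: "p \<in> P"
    obtain A B where "p = (A, B)" by (cases p)
    with p show "(case p of (A, B) \<Rightarrow> avg Q es (\<lambda>\<phi>. of_bool (no_shared_free_color Q V A B \<phi>)) (\<lambda>_. 0)) \<le> b"
      using avg_no_shared_free_color_le[OF V, of A B a M es u "\<lambda>_. 0"] M u es
      by (simp add: P_def b_def Q_def)
  qed
  also have "\<dots> \<le> real (card V) ^ (2 * a) * b" using cardP b by (rule mult_right_mono)
  also have "\<dots> < 1" using small by (simp add: b_def Q_def)
  finally obtain \<phi> where "(\<Sum>(A, B)\<in>P. of_bool (no_shared_free_color Q V A B \<phi>) :: real) < 1"
    using exists_less_avg[OF Q] by blast
  moreover have "(\<Sum>(A, B)\<in>P. of_bool (no_shared_free_color Q V A B \<phi>) :: real)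
    = real (card {(A, B) \<in> P. no_shared_free_color Q V A B \<phi>})"
    using finP by (simp add: case_prod_unfold of_bool_def sum.If_cases Int_def)
  ultimately have "card {(A, B) \<in> P. no_shared_free_color Q V A B \<phi>} = 0" by simp
  moreover have "finite {(A, B) \<in> P. no_shared_free_color Q V A B \<phi>}"
    using finP by (rule finite_subset[rotated]) auto
  ultimately have "{(A, B) \<in> P. no_shared_free_color Q V A B \<phi>} = {}" by simp
  then show ?thesis by (intro exI[of _ \<phi>]) (auto simp: P_def Q_def)
qed

text \<open>The point is maximality of the matching kept in each color class: an edge that loses its
  color meets one that keeps it.\<close>

lemma exists_proper_from_map:
  fixes V :: "'a set" and \<phi> :: "'a set \<Rightarrow> nat"
  assumes V: "finite V"
  shows "\<exists>c. proper_edge_coloring (V, [V]\<^bsup>2\<^esup>) c \<and>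
    (\<forall>e\<in>[V]\<^bsup>2\<^esup>. \<phi> e < Q \<longrightarrow> (\<exists>e'\<in>[V]\<^bsup>2\<^esup>. e' \<inter> e \<noteq> {} \<and> \<phi> e' = \<phi> e \<and> c e' = \<phi> e))"
proof -
  have finE: "finite ([V]\<^bsup>2\<^esup>)" using V finite_imp_finite_nsets by blast
  from finite_imp_inj_to_nat_seg[OF finE] obtain idx :: "'a set \<Rightarrow> nat"
    where idx: "inj_on idx ([V]\<^bsup>2\<^esup>)"
    by (elim exE conjE)
  define matching where
    "matching k S \<longleftrightarrow> S \<subseteq> {e \<in> [V]\<^bsup>2\<^esup>. \<phi> e = k} \<and> (\<forall>e\<in>S. \<forall>f\<in>S. e \<noteq> f \<longrightarrow> e \<inter> f = {})" for k S
  have "\<exists>S. matching k S \<and> (\<forall>S'. matching k S' \<longrightarrow> S \<subseteq> S' \<longrightarrow> S' = S)" for k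
  proof -
    have fin: "finite {S. matching k S}"
      by (rule finite_subset[of _ "Pow ([V]\<^bsup>2\<^esup>)"]) (use finE in \<open>auto simp: matching_def\<close>)
    have "matching k {}" by (simp add: matching_def)
    then have ne: "{S. matching k S} \<noteq> {}" by blast
    from finite_has_maximal[OF fin ne] obtain m
      where "matching k m" "\<forall>b\<in>{S. matching k S}. m \<subseteq> b \<longrightarrow> m = b"
      by (elim bexE) simp
    then show ?thesis by (intro exI[of _ m]) auto
  qed
  then obtain S where S: "\<And>k. matching k (S k)" "\<And>k S'. matching k S' \<Longrightarrow> S k \<subseteq> S' \<Longrightarrow> S' = S k"
    by metis
  \<comment> \<open>Private colors start at \<open>Q\<close>, above all kept colors.\<close>
  define c where "c e = (if \<phi> e < Q \<and> e \<in> S (\<phi> e) then \<phi> e else Q + idx e)" for e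
  have "proper_edge_coloring (V, [V]\<^bsup>2\<^esup>) c"
    unfolding proper_edge_coloring_def
  proof (intro ballI impI, simp, elim conjE)
    fix e f assume h: "e \<in> [V]\<^bsup>2\<^esup>" "f \<in> [V]\<^bsup>2\<^esup>" "e \<noteq> f" "e \<inter> f \<noteq> {}"
    show "c e \<noteq> c f"
    proof
      assume eq: "c e = c f"
      have "idx e \<noteq> idx f" using idx h by (auto simp: inj_on_def)
      then have "\<phi> e = \<phi> f" "e \<in> S (\<phi> e)" "f \<in> S (\<phi> e)" using eq by (auto simp: c_def split: if_splits)
      then show False using S(1)[of "\<phi> e"] h unfolding matching_def by blast
    qed
  qed
  moreover have "\<exists>e'\<in>[V]\<^bsup>2\<^esup>. e' \<inter> e \<noteq> {} \<and> \<phi> e' = \<phi> e \<and> c e' = \<phi> e"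
    if e: "e \<in> [V]\<^bsup>2\<^esup>" "\<phi> e < Q" for e
  proof (cases "e \<in> S (\<phi> e)")
    case True
    then show ?thesis using e by (intro bexI[of _ e]) (auto simp: c_def nsets_def)
  next
    case False
    have "\<not> matching (\<phi> e) (insert e (S (\<phi> e)))"
      using S(2)[of "\<phi> e" "insert e (S (\<phi> e))"] False by blast
    then obtain e' where "e' \<in> S (\<phi> e)" "e' \<inter> e \<noteq> {}"
      using S(1)[of "\<phi> e"] e(1) unfolding matching_def by blast
    moreover from this have "e' \<in> [V]\<^bsup>2\<^esup>" "\<phi> e' = \<phi> e" using S(1)[of "\<phi> e"] by (auto simp: matching_def)
    ultimately show ?thesis using e by (intro bexI[of _ e']) (auto simp: c_def)
  qed
  ultimately show ?thesis by blast
qed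

text \<open>A \<open>K\<close> of size 2a is halved into \<open>A\<close> and \<open>B\<close>. A
  shared free color of \<open>e\<close> and \<open>f\<close> is kept on an edge meeting
  \<open>e\<close>; freeness keeps this edge out of \<open>R\<close>, so it lies inside
  \<open>A\<close>. The same holds for \<open>f\<close> and \<open>B\<close>, which yields two edges
  of \<open>K\<close> with one color.\<close>

lemma exists_proper_without_rainbow:
  fixes V :: "'a set"
  assumes V: "finite V" "V \<noteq> {}" and M: "M = a choose 2" "M \<le> 2 * card V" and u: "16 * u \<le> M"
    and small: "real (card V) ^ (2 * a) * (real M * (1/4) ^ u + (1 - real u / real (8 * card V)) ^ M) < 1"
  shows "\<exists>c. proper_edge_coloring (V, [V]\<^bsup>2\<^esup>) c \<and> (\<forall>K\<subseteq>V. card K = 2 * a \<longrightarrow> \<not> inj_on c ([K]\<^bsup>2\<^esup>))"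
proof -
  define Q where "Q = 8 * card V"
  obtain \<phi> where \<phi>: "\<And>A B. A \<subseteq> V \<Longrightarrow> B \<subseteq> V \<Longrightarrow> A \<inter> B = {} \<Longrightarrow> card A = a \<Longrightarrow> card B = a
    \<Longrightarrow> \<not> no_shared_free_color Q V A B \<phi>"
    using exists_edge_map_all_shared[OF assms] unfolding Q_def by blast
  obtain c where c: "proper_edge_coloring (V, [V]\<^bsup>2\<^esup>) c"
    "\<And>e. e \<in> [V]\<^bsup>2\<^esup> \<Longrightarrow> \<phi> e < Q \<Longrightarrow> \<exists>e'\<in>[V]\<^bsup>2\<^esup>. e' \<inter> e \<noteq> {} \<and> \<phi> e' = \<phi> e \<and> c e' = \<phi> e"
    using exists_proper_from_map[OF V(1), of \<phi> Q] by blast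
  have "\<not> inj_on c ([K]\<^bsup>2\<^esup>)" if K: "K \<subseteq> V" "card K = 2 * a" for K
  proof
    assume inj: "inj_on c ([K]\<^bsup>2\<^esup>)"
    have fK: "finite K" using K V finite_subset by blast
    obtain A where A: "A \<subseteq> K" "card A = a" using obtain_subset_with_card_n[of a K] K by auto
    define B where "B = K - A"
    have B: "B \<subseteq> K" "card B = a" "A \<inter> B = {}"
      using A K fK finite_subset[OF A(1)] by (auto simp: B_def card_Diff_subset)
    define R where "R = [V]\<^bsup>2\<^esup> - [A]\<^bsup>2\<^esup> - [B]\<^bsup>2\<^esup>"
    obtain e f where ef: "e \<in> [A]\<^bsup>2\<^esup>" "f \<in> [B]\<^bsup>2\<^esup>" "\<phi> e = \<phi> f"
      "\<phi> e \<in> free_colors Q R \<phi> e" "\<phi> f \<in> free_colors Q R \<phi> f"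
      using \<phi>[of A B] A B K unfolding no_shared_free_color_def R_def by fastforce
    have *: "\<exists>e'\<in>[A]\<^bsup>2\<^esup>. c e' = \<phi> e"
      if h: "e \<in> [A]\<^bsup>2\<^esup>" "\<phi> e \<in> free_colors Q R \<phi> e" "A \<inter> B = {}" "A \<subseteq> V" and R: "R = [V]\<^bsup>2\<^esup> - [A]\<^bsup>2\<^esup> - [B]\<^bsup>2\<^esup>" for A B e
    proof -
      have "e \<in> [V]\<^bsup>2\<^esup>" "\<phi> e < Q" using h nsets_mono[of A V 2] by (auto simp: free_colors_def)
      then obtain e' where e': "e' \<in> [V]\<^bsup>2\<^esup>" "e' \<inter> e \<noteq> {}" "\<phi> e' = \<phi> e" "c e' = \<phi> e"
        using c(2) by blast
      then have "e' \<notin> R" using h(2) by (auto simp: free_colors_def)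
      moreover have "e' \<notin> [B]\<^bsup>2\<^esup>" using e'(2) h by (auto simp: nsets_def)
      ultimately show ?thesis using e' R by blast
    qed
    obtain e' where e': "e' \<in> [A]\<^bsup>2\<^esup>" "c e' = \<phi> e"
      using *[OF ef(1,4) B(3)] A K R_def by blast
    obtain f' where f': "f' \<in> [B]\<^bsup>2\<^esup>" "c f' = \<phi> f"
    proof -
      have "R = [V]\<^bsup>2\<^esup> - [B]\<^bsup>2\<^esup> - [A]\<^bsup>2\<^esup>" by (auto simp: R_def)
      moreover have "B \<inter> A = {}" "B \<subseteq> V" using B K by auto
      ultimately show ?thesis using *[OF ef(2,5)] that by blast
    qed
    have "e' \<noteq> f'"
    proof
      assume "e' = f'"
      then have "e' \<subseteq> A \<inter> B" "card e' = 2" using e' f' by (auto simp: nsets_def)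
      then show False using B(3) by simp
    qed
    moreover have "e' \<in> [K]\<^bsup>2\<^esup>" "f' \<in> [K]\<^bsup>2\<^esup>" using e' f' A(1) B(1) nsets_mono by blast+
    ultimately show False using inj e' f' ef(3) by (auto simp: inj_on_def)
  qed
  then show ?thesis using c(1) by blast
qed

section \<open>Graphs with few edges\<close>

text \<open>The number of pairs is at most exp(6 a ln a). The first failure term is exp(-c a^2) up
  to a polynomial factor; the second is at most exp(-uM/(8N)), and \<kappa> is small enough to make
  this at most exp(-8 a ln a).\<close>

lemma sparse_clique_parameters:
  defines "\<kappa> \<equiv> 1 / 32768 :: real"
  shows "\<exists>a\<^sub>0. \<forall>a\<ge>a\<^sub>0. \<forall>N M u. N = nat \<lfloor>\<kappa> * real a ^ 3 / ln (real a)\<rfloor> \<and> M = a choose 2 \<and> u = M div 16 \<longrightarrow>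
    0 < N \<and> M \<le> 2 * N \<and>
    real N ^ (2 * a) * (real M * (1/4) ^ u + (1 - real u / real (8 * N)) ^ M) < 1"
proof -
  have exp_m1: "exp (- 1 :: real) < 1 / 2"
    using exp_lower_Taylor_quadratic[of "1::real"] by (simp add: exp_minus field_simps)
  have "0 < N \<and> M \<le> 2 * N \<and> real N ^ (2 * a) * (real M * (1/4) ^ u + (1 - real u / real (8 * N)) ^ M) < 1"
    if a: "a \<ge> 17179869184" and N: "N = nat \<lfloor>\<kappa> * real a ^ 3 / ln (real a)\<rfloor>" and M: "M = a choose 2" and u: "u = M div 16"
    for a N M u :: nat
  proof -
    define x where "x = real a"
    define L where "L = ln x"
    have x: "x \<ge> 17179869184" using a by (simp add: x_def)
    have L: "L \<ge> 1"
    proof -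
      have "exp 1 \<le> x" using exp_le x by linarith
      then show ?thesis using x by (simp add: L_def ln_ge_iff)
    qed
    \<comment> \<open>The threshold for \<open>a\<close> is 131072^2, and 65536 is 2/\<kappa>: this
      gives \<kappa> x^3/L \<ge> 2 x^2, hence N \<ge> x^2 after rounding down.\<close>
    have Lx: "65536 * L \<le> x"
    proof -
      have "sqrt 17179869184 \<le> sqrt x" using x by (intro real_sqrt_le_mono)
      moreover have "sqrt 17179869184 = (131072::real)" by (rule real_sqrt_unique) simp_all
      ultimately have "131072 * sqrt x \<le> sqrt x * sqrt x" using x by (intro mult_right_mono) auto
      also have "\<dots> = x" using x by simp
      finally have "131072 * sqrt x \<le> x" .
      moreover have "L = 2 * ln (sqrt x)" using x by (simp add: L_def ln_sqrt)
      moreover have "ln (sqrt x) \<le> sqrt x" using x ln_le_minus_one[of "sqrt x"] by simp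
      ultimately show ?thesis by simp
    qed
    have pos: "\<kappa> * x ^ 3 / L \<ge> 0" using x L by (simp add: \<kappa>_def)
    have N_le: "real N \<le> \<kappa> * x ^ 3 / L" using pos by (simp add: N x_def L_def)
    have N_ge: "real N \<ge> x ^ 2"
    proof -
      have "x ^ 2 * (65536 * L) \<le> x ^ 2 * x" using Lx by (intro mult_left_mono) auto
      then have "2 * x ^ 2 \<le> \<kappa> * x ^ 3 / L" using L by (simp add: \<kappa>_def field_simps eval_nat_numeral)
      moreover have "x ^ 2 \<ge> 1" using x by (simp add: one_le_power)
      moreover have "\<kappa> * x ^ 3 / L < real N + 1"
        using pos by (simp add: N x_def[symmetric] L_def[symmetric])
      ultimately show ?thesis by linarith
    qed
    have "x * 100 \<le> x * x" using x by (intro mult_left_mono) auto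
    then have xx: "x ^ 2 \<ge> 100 * x" by (simp add: power2_eq_square)
    have Npos: "N > 0" using N_ge xx x by (cases "N = 0") auto
    have "M = a * (a - 1) div 2" by (simp add: M choose_two)
    moreover have "even (a * (a - 1))" by auto
    ultimately have "real M = real (a * (a - 1)) / 2" by (simp add: real_of_nat_div)
    then have M_eq: "real M = x * (x - 1) / 2" using x by (simp add: x_def of_nat_diff)
    have M_ge: "real M \<ge> x ^ 2 / 4" and M_le: "real M \<le> x ^ 2"
      using xx x by (simp_all add: M_eq power2_eq_square field_simps)
    have "16 * u + 16 > M" using u by presburger
    then have "16 * real u + 16 > real M" by linarith
    then have u_ge: "real u \<ge> x ^ 2 / 128" using M_ge xx x by linarith
    have MN: "M \<le> 2 * N" using M_le N_ge by linarith
    have uN: "u \<le> 8 * N" using u MN by linarith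
    have NL: "real N * L \<le> \<kappa> * x ^ 3" using N_le L by (simp add: field_simps)
    have "1 * x ^ 3 \<le> L * (x ^ 3 * 32768)" using L x by (intro mult_mono) auto
    then have "\<kappa> * x ^ 3 / L \<le> x ^ 3" using L x by (simp add: \<kappa>_def field_simps)
    then have "real N ^ (2 * a) \<le> (x ^ 3) ^ (2 * a)" using N_le by (intro power_mono) auto
    also have "\<dots> = exp L ^ (6 * a)" using x by (simp add: L_def flip: power_mult)
    also have "\<dots> = exp (6 * x * L)" by (simp add: x_def flip: exp_of_nat_mult)
    finally have N_pow: "real N ^ (2 * a) \<le> exp (6 * x * L)" .
    have "(1/4::real) ^ u \<le> exp (-1) ^ u"
      using exp_le by (intro power_mono) (auto simp: exp_minus field_simps)
    also have "\<dots> = exp (- real u)" by (simp flip: exp_of_nat_mult)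
    also have "\<dots> \<le> exp (- (x ^ 2) / 128)" using u_ge by simp
    finally have "real N ^ (2 * a) * (real M * (1/4) ^ u) \<le> exp (6 * x * L) * (x ^ 2 * exp (- (x ^ 2) / 128))"
      using N_pow M_le by (intro mult_mono) auto
    also have "\<dots> = exp (6 * x * L + 2 * L - x ^ 2 / 128)"
    proof -
      have "x ^ 2 = exp (2 * L)" using x by (simp add: L_def exp_double)
      then show ?thesis by (simp flip: exp_add) 
    qed
    also have "\<dots> \<le> exp (- 1)"
    proof -
      have "65536 * (x * L) \<le> x ^ 2" using mult_left_mono[OF Lx, of x] x by (simp add: power2_eq_square)
      moreover have "1 * L \<le> x * L" using x L by (intro mult_right_mono) auto
      ultimately show ?thesis using xx x by simp
    qed
    also have "exp (- 1 :: real) < 1 / 2" by (rule exp_m1)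
    finally have first: "real N ^ (2 * a) * (real M * (1/4) ^ u) < 1 / 2" .
    have "(1 - real u / real (8 * N)) ^ M \<le> exp (- (real u / real (8 * N))) ^ M"
      using uN Npos exp_ge_add_one_self[of "- (real u / real (8 * N))"]
      by (intro power_mono) (auto simp: field_simps)
    also have "\<dots> = exp (- (real M * (real u / real (8 * N))))" by (simp flip: exp_of_nat_mult)
    also have "\<dots> \<le> exp (- (8 * x * L))"
    proof -
      have "64 * (x * (real N * L)) \<le> 64 * (x * (\<kappa> * x ^ 3))" using NL x by (intro mult_left_mono) auto
      also have "\<dots> = (x ^ 2 / 4) * (x ^ 2 / 128)" by (simp add: \<kappa>_def eval_nat_numeral)
      also have "\<dots> \<le> real M * real u" using M_ge u_ge by (intro mult_mono) auto
      finally show ?thesis using Npos by (simp add: field_simps)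
    qed
    finally have "real N ^ (2 * a) * (1 - real u / real (8 * N)) ^ M \<le> exp (6 * x * L) * exp (- (8 * x * L))"
      using N_pow uN Npos by (intro mult_mono) auto
    also have "\<dots> = exp (- (2 * x * L))" by (simp flip: exp_add)
    also have "\<dots> \<le> exp (- 1)"
    proof -
      have "1 * 1 \<le> (2 * x) * L" using x L by (intro mult_mono) auto
      then show ?thesis by simp
    qed
    also have "exp (- 1 :: real) < 1 / 2" by (rule exp_m1)
    finally show ?thesis using first Npos MN by (simp add: distrib_left)
  qed
  then show ?thesis by blast
qed

text \<open>The estimate concerns exactly \<open>N\<close> vertices, so a smaller \<open>V\<close>
  is first padded with new vertices and the coloring is restricted afterwards.\<close>

lemma exists_proper_without_rainbow_asymptotic:
  "\<exists>\<kappa>>0. \<exists>a\<^sub>0. \<forall>a\<ge>a\<^sub>0. \<forall>V :: nat set. finite V \<and> real (card V) \<le> \<kappa> * real a ^ 3 / ln (real a) \<longrightarrow>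
    (\<exists>c. proper_edge_coloring (V, [V]\<^bsup>2\<^esup>) c \<and> (\<forall>K\<subseteq>V. card K = 2 * a \<longrightarrow> \<not> inj_on c ([K]\<^bsup>2\<^esup>)))"
proof -
  define \<kappa> :: real where "\<kappa> = 1 / 32768"
  obtain a\<^sub>0 where a0: "\<And>a N M u. a \<ge> a\<^sub>0 \<Longrightarrow> N = nat \<lfloor>\<kappa> * real a ^ 3 / ln (real a)\<rfloor> \<Longrightarrow> M = a choose 2 \<Longrightarrow> u = M div 16 \<Longrightarrow>
    0 < N \<and> M \<le> 2 * N \<and>
    real N ^ (2 * a) * (real M * (1/4) ^ u + (1 - real u / real (8 * N)) ^ M) < 1"
    using sparse_clique_parameters unfolding \<kappa>_def by metis
  have "\<exists>c. proper_edge_coloring (V, [V]\<^bsup>2\<^esup>) c \<and> (\<forall>K\<subseteq>V. card K = 2 * a \<longrightarrow> \<not> inj_on c ([K]\<^bsup>2\<^esup>))"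
    if a: "a \<ge> a\<^sub>0" and V: "finite V" "real (card V) \<le> \<kappa> * real a ^ 3 / ln (real a)" for a and V :: "nat set"
  proof -
    define N where "N = nat \<lfloor>\<kappa> * real a ^ 3 / ln (real a)\<rfloor>"
    have "card V \<le> N" using V(2) by (simp add: N_def le_nat_floor)
    moreover have "infinite (- V)" using V(1) by simp
    then obtain W where W: "W \<subseteq> - V" "finite W" "card W = N - card V"
      using infinite_arbitrarily_large by blast
    define V' where "V' = V \<union> W"
    have "V \<inter> W = {}" using W by blast
    ultimately have V': "V \<subseteq> V'" "finite V'" "card V' = N"
      using W V by (auto simp: V'_def card_Un_disjoint)
    note p = a0[OF a N_def refl refl]
    have "V' \<noteq> {}" using p V' by auto
    then obtain c where c: "proper_edge_coloring (V', [V']\<^bsup>2\<^esup>) c"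
      "\<forall>K\<subseteq>V'. card K = 2 * a \<longrightarrow> \<not> inj_on c ([K]\<^bsup>2\<^esup>)"
      using exists_proper_without_rainbow[of V' "a choose 2" a "(a choose 2) div 16"] p V' by auto
    have "proper_edge_coloring (V, [V]\<^bsup>2\<^esup>) c"
      using c(1) nsets_mono[OF V'(1), of 2] unfolding proper_edge_coloring_def by (simp add: subset_iff)
    then show ?thesis using c(2) V'(1) by (intro exI[of _ c]) blast
  qed
  moreover have "\<kappa> > 0" by (simp add: \<kappa>_def)
  ultimately show ?thesis by blast
qed

section \<open>Splitting a graph by degree\<close>

lemma greedy_edge_coloring:
  fixes E :: "'a set set"
  assumes "finite E" "\<And>e. e \<in> E \<Longrightarrow> card {f \<in> E. f \<noteq> e \<and> e \<inter> f \<noteq> {}} < d"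
  shows "\<exists>c :: 'a set \<Rightarrow> nat. (\<forall>e\<in>E. c e < d) \<and> (\<forall>e\<in>E. \<forall>f\<in>E. e \<noteq> f \<and> e \<inter> f \<noteq> {} \<longrightarrow> c e \<noteq> c f)"
  using assms
proof (induction E rule: finite_induct)
  case (insert x E)
  have "card {f \<in> E. f \<noteq> e \<and> e \<inter> f \<noteq> {}} < d" if "e \<in> E" for e
  proof -
    have "card {f \<in> E. f \<noteq> e \<and> e \<inter> f \<noteq> {}} \<le> card {f \<in> insert x E. f \<noteq> e \<and> e \<inter> f \<noteq> {}}"
      using insert.hyps by (intro card_mono) auto
    then show ?thesis using insert.prems[of e] that by simp
  qed
  then obtain c :: "'a set \<Rightarrow> nat" where c: "\<forall>e\<in>E. c e < d" "\<forall>e\<in>E. \<forall>f\<in>E. e \<noteq> f \<and> e \<inter> f \<noteq> {} \<longrightarrow> c e \<noteq> c f"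
    using insert.IH by blast
  define S where "S = {f \<in> E. x \<inter> f \<noteq> {}}"
  have finS: "finite S" using insert.hyps by (simp add: S_def)
  have "S = {f \<in> insert x E. f \<noteq> x \<and> x \<inter> f \<noteq> {}}" using insert.hyps by (auto simp: S_def)
  then have "card S < d" using insert.prems[of x] by simp
  then have "card (c ` S) < d" using card_image_le[OF finS, of c] by simp
  then have "\<not> {..<d} \<subseteq> c ` S"
    using card_mono[of "c ` S" "{..<d}"] finS by auto
  then obtain k where k: "k < d" "k \<notin> c ` S" by blast
  show ?case
    using c k insert.hyps by (intro exI[of _ "c(x := k)"]) (auto simp: S_def)
qed simp

text \<open>Of the at least 2b vertices of a rainbow clique, b lie in \<open>H\<close> or b lie in
  its complement \<open>L\<close>. The former contradicts the choice of \<open>cH\<close>; the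
  latter would need more than the 2D colors that the greedy coloring uses inside \<open>L\<close>.
  Crossing edges get private colors.\<close>

lemma not_forces_if_high_degree_colorable:
  fixes G :: "'a graph"
  assumes G: "finite_simple_graph G"
    and H: "H = {v \<in> verts G. D \<le> card {e \<in> edges G. v \<in> e}}"
    and cH: "proper_edge_coloring (H, [H]\<^bsup>2\<^esup>) cH" "\<forall>K\<subseteq>H. card K = b \<longrightarrow> \<not> inj_on cH ([K]\<^bsup>2\<^esup>)"
    and D: "2 * D < b choose 2" "D > 0" and n: "2 * b \<le> n"
  shows "\<not> forces_rainbow G (complete_graph n)"
proof
  assume "forces_rainbow G (complete_graph n)"
  note forces = this[unfolded forces_rainbow_complete_iff, rule_format]
  have E: "finite (verts G)" "edges G \<subseteq> [verts G]\<^bsup>2\<^esup>" using G by (auto simp: finite_simple_graph_def)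
  then have finE: "finite (edges G)" using finite_imp_finite_nsets finite_subset by metis
  define L where "L = verts G - H"
  define EL where "EL = {e \<in> edges G. e \<subseteq> L}"
  have finEL: "finite EL" using finE by (simp add: EL_def)
  have "card {f \<in> EL. f \<noteq> e \<and> e \<inter> f \<noteq> {}} < 2 * D" if e: "e \<in> EL" for e
  proof -
    obtain x y where xy: "e = {x, y}" using e E by (auto simp: EL_def nsets_def card_2_iff)
    then have L: "x \<in> L" "y \<in> L" using e by (auto simp: EL_def)
    have deg: "card {f \<in> edges G. v \<in> f} \<le> D - 1" if "v \<in> L" for v
      using that by (auto simp: L_def H)
    have "card {f \<in> EL. f \<noteq> e \<and> e \<inter> f \<noteq> {}} \<le> card ({f \<in> edges G. x \<in> f} \<union> {f \<in> edges G. y \<in> f})"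
      using finE by (intro card_mono) (auto simp: EL_def xy)
    also have "\<dots> \<le> (D - 1) + (D - 1)"
      by (intro order_trans[OF card_Un_le] add_mono deg L)
    finally show ?thesis using D by simp
  qed
  then have "\<exists>c :: 'a set \<Rightarrow> nat. (\<forall>e\<in>EL. c e < 2 * D) \<and> (\<forall>e\<in>EL. \<forall>f\<in>EL. e \<noteq> f \<and> e \<inter> f \<noteq> {} \<longrightarrow> c e \<noteq> c f)"
    by (rule greedy_edge_coloring[OF finEL])
  then obtain cL :: "'a set \<Rightarrow> nat"
    where "\<forall>e\<in>EL. cL e < 2 * D" "\<forall>e\<in>EL. \<forall>f\<in>EL. e \<noteq> f \<and> e \<inter> f \<noteq> {} \<longrightarrow> cL e \<noteq> cL f"
    by (elim exE conjE)
  then have cL: "cL e < 2 * D" "f \<in> EL \<Longrightarrow> e \<noteq> f \<Longrightarrow> e \<inter> f \<noteq> {} \<Longrightarrow> cL e \<noteq> cL f"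
    if "e \<in> EL" for e f
    using that by simp_all
  from finite_imp_inj_to_nat_seg[OF finE] obtain idx :: "'a set \<Rightarrow> nat"
    where idx: "inj_on idx (edges G)" by (elim exE conjE)
  \<comment> \<open>The residue modulo 3 keeps the palettes for edges inside \<open>H\<close>, edges
    inside \<open>L\<close> and crossing edges apart.\<close>
  define c where "c e = (if e \<subseteq> H then 3 * cH e else if e \<subseteq> L then 3 * cL e + 1 else 3 * idx e + 2)" for e
  have "proper_edge_coloring G c"
    unfolding proper_edge_coloring_def
  proof (intro ballI impI, elim conjE)
    fix e f assume h: "e \<in> edges G" "f \<in> edges G" "e \<noteq> f" "e \<inter> f \<noteq> {}"
    have "cH e \<noteq> cH f" if "e \<subseteq> H" "f \<subseteq> H"
    proof -
      have "e \<in> [H]\<^bsup>2\<^esup>" "f \<in> [H]\<^bsup>2\<^esup>" using h E that by (auto simp: nsets_def)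
      then show ?thesis using cH(1) h unfolding proper_edge_coloring_def by auto
    qed
    moreover have "cL e \<noteq> cL f" if "e \<subseteq> L" "f \<subseteq> L" using cL(2)[of e f] h that by (simp add: EL_def)
    moreover have "idx e \<noteq> idx f" using idx h by (auto simp: inj_on_def)
    ultimately show "c e \<noteq> c f" unfolding c_def by (auto split: if_splits) presburger+
  qed
  from forces[OF this] obtain K where K: "K \<subseteq> verts G" "finite K" "card K = n" "[K]\<^bsup>2\<^esup> \<subseteq> edges G" "inj_on c ([K]\<^bsup>2\<^esup>)"
    by blast
  have "K = (K \<inter> H) \<union> (K \<inter> L)" "(K \<inter> H) \<inter> (K \<inter> L) = {}" using K by (auto simp: L_def)
  then have "n = card (K \<inter> H) + card (K \<inter> L)" using K card_Un_disjoint[of "K \<inter> H" "K \<inter> L"] by auto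
  then consider "b \<le> card (K \<inter> H)" | "b \<le> card (K \<inter> L)" using n by linarith
  then show False
  proof cases
    case 1
    then obtain J where J: "J \<subseteq> K \<inter> H" "card J = b" using obtain_subset_with_card_n by metis
    have "inj_on cH ([J]\<^bsup>2\<^esup>)"
    proof (rule inj_onI)
      fix e f assume h: "e \<in> [J]\<^bsup>2\<^esup>" "f \<in> [J]\<^bsup>2\<^esup>" "cH e = cH f"
      then have "e \<in> [K]\<^bsup>2\<^esup>" "f \<in> [K]\<^bsup>2\<^esup>" "e \<subseteq> H" "f \<subseteq> H" using J by (auto simp: nsets_def)
      moreover from this have "c e = c f" using h by (simp add: c_def)
      ultimately show "e = f" using K(5) by (auto simp: inj_on_def)
    qed
    then show False using cH(2) J by blast
  next
    case 2
    then obtain J where J: "J \<subseteq> K \<inter> L" "card J = b" using obtain_subset_with_card_n by metis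
    have fJ: "finite J" using J K finite_subset by blast
    have in_EL: "e \<in> EL" "e \<in> [K]\<^bsup>2\<^esup>" "e \<subseteq> L" "\<not> e \<subseteq> H" if "e \<in> [J]\<^bsup>2\<^esup>" for e
    proof -
      show K2: "e \<in> [K]\<^bsup>2\<^esup>" and eL: "e \<subseteq> L" using J that by (auto simp: nsets_def)
      then show "e \<in> EL" using K by (auto simp: EL_def)
      have "e \<noteq> {}" using that by (auto simp: nsets_def)
      then show "\<not> e \<subseteq> H" using eL by (auto simp: L_def)
    qed
    have "inj_on cL ([J]\<^bsup>2\<^esup>)"
    proof (rule inj_onI)
      fix e f assume h: "e \<in> [J]\<^bsup>2\<^esup>" "f \<in> [J]\<^bsup>2\<^esup>" "cL e = cL f"
      then have "c e = c f" using in_EL[OF h(1)] in_EL[OF h(2)] by (simp add: c_def)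
      then show "e = f" using K(5) in_EL[OF h(1)] in_EL[OF h(2)] by (auto simp: inj_on_def)
    qed
    moreover have "cL ` [J]\<^bsup>2\<^esup> \<subseteq> {..<2 * D}" using in_EL cL(1) by auto
    ultimately have "card ([J]\<^bsup>2\<^esup>) \<le> card {..<2 * D}" by (intro card_inj_on_le) auto
    then show False using D J by (simp add: card_nsets)
  qed
qed

text \<open>The degrees sum to twice the number of edges.\<close>

lemma card_high_degree_le:
  assumes G: "finite_simple_graph G"
  shows "D * card {v \<in> verts G. D \<le> card {e \<in> edges G. v \<in> e}} \<le> 2 * card (edges G)"
proof -
  have E: "finite (verts G)" "edges G \<subseteq> [verts G]\<^bsup>2\<^esup>" using G by (auto simp: finite_simple_graph_def)
  then have finE: "finite (edges G)" using finite_imp_finite_nsets finite_subset by metis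
  let ?H = "{v \<in> verts G. D \<le> card {e \<in> edges G. v \<in> e}}"
  have "D * card ?H = (\<Sum>v\<in>?H. D)" by simp
  also have "\<dots> \<le> (\<Sum>v\<in>?H. card {e \<in> edges G. v \<in> e})" by (rule sum_mono) simp
  also have "\<dots> \<le> (\<Sum>v\<in>verts G. card {e \<in> edges G. v \<in> e})" using E by (intro sum_mono2) auto
  also have "\<dots> = (\<Sum>v\<in>verts G. \<Sum>e\<in>edges G. if v \<in> e then 1 else 0)"
    using finE by (simp add: sum.If_cases Int_def)
  also have "\<dots> = (\<Sum>e\<in>edges G. \<Sum>v\<in>verts G. if v \<in> e then 1 else 0)" by (rule sum.swap)
  also have "\<dots> = (\<Sum>e\<in>edges G. 2)"
  proof (rule sum.cong)
    fix e assume "e \<in> edges G"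
    then have "{v \<in> verts G. v \<in> e} = e" "card e = 2" using E by (auto simp: nsets_def)
    then show "(\<Sum>v\<in>verts G. if v \<in> e then 1 else 0) = (2::nat)"
      using E by (simp add: sum.If_cases Int_def)
  qed simp
  finally show ?thesis by simp
qed

text \<open>With a = n div 4 and degree threshold about a^2/2, few edges leave at most \<kappa>
  a^3/ln a vertices of high degree. The splitting applies with b = 2a, since 2D \<le> a^2 is less
  than 2a choose 2 and 4a \<le> n.\<close>

lemma edges_of_forcing_graph_large:
  "\<exists>c>0. \<exists>n\<^sub>0. \<forall>n\<ge>n\<^sub>0. \<forall>G :: nat graph. finite_simple_graph G \<and> forces_rainbow G (complete_graph n)
    \<longrightarrow> c * real n ^ 5 / ln (real n) \<le> real (card (edges G))"
proof -
  obtain \<kappa> a\<^sub>0 where \<kappa>: "\<kappa> > 0" and col: "\<And>a V. a \<ge> a\<^sub>0 \<Longrightarrow> finite (V :: nat set) \<Longrightarrow>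
    real (card V) \<le> \<kappa> * real a ^ 3 / ln (real a) \<Longrightarrow>
    \<exists>c. proper_edge_coloring (V, [V]\<^bsup>2\<^esup>) c \<and> (\<forall>K\<subseteq>V. card K = 2 * a \<longrightarrow> \<not> inj_on c ([K]\<^bsup>2\<^esup>))"
    using exists_proper_without_rainbow_asymptotic by metis
  \<comment> \<open>8^5 pays for n \<le> 8a, and the other 8 for the factor 2 of the degree sum and
    for D \<ge> a^2/4.\<close>
  define c where "c = \<kappa> / (8 * 8 ^ 5)"
  have "c * real n ^ 5 / ln (real n) \<le> real (card (edges G))"
    if n: "n \<ge> 4 * a\<^sub>0 + 8" and G: "finite_simple_graph G" "forces_rainbow G (complete_graph n)" for n and G :: "nat graph"
  proof (rule ccontr)
    assume "\<not> ?thesis"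
    then have few: "real (card (edges G)) < c * real n ^ 5 / ln (real n)" by simp
    define a where "a = n div 4"
    define D where "D = a\<^sup>2 div 2"
    define H where "H = {v \<in> verts G. D \<le> card {e \<in> edges G. v \<in> e}}"
    have a: "a \<ge> a\<^sub>0" "a \<ge> 2" "n \<le> 8 * a" "4 * a \<le> n" using n by (auto simp: a_def)
    have finH: "finite H" using G(1) by (simp add: H_def finite_simple_graph_def)
    have "a \<le> a\<^sup>2" "4 \<le> a\<^sup>2" using a(2) power_mono[of 2 a 2] by (auto simp: power2_eq_square)
    then have D: "2 * D \<le> a\<^sup>2" "4 * D \<ge> a\<^sup>2" "D > 0" by (auto simp: D_def)
    have lna: "0 < ln (real a)" "ln (real a) \<le> ln (real n)" using a by auto
    have "real (card H) \<le> \<kappa> * real a ^ 3 / ln (real a)"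
    proof -
      have "real (D * card H) \<le> real (2 * card (edges G))"
        using card_high_degree_le[OF G(1), of D] unfolding H_def of_nat_le_iff .
      then have "real D * real (card H) \<le> 2 * real (card (edges G))" by simp
      also have "\<dots> \<le> 2 * (c * real n ^ 5 / ln (real n))" using few by simp
      also have "\<dots> \<le> 2 * (c * (8 * real a) ^ 5 / ln (real a))"
        using a lna \<kappa> by (intro mult_left_mono frac_le power_mono) (auto simp: c_def)
      also have "\<dots> = (real a ^ 2 / 4) * (\<kappa> * real a ^ 3 / ln (real a))"
        by (simp add: c_def power_mult_distrib eval_nat_numeral)
      also have "\<dots> \<le> real D * (\<kappa> * real a ^ 3 / ln (real a))"
      proof (rule mult_right_mono)
        have "real (a\<^sup>2) \<le> real (4 * D)" using D(2) of_nat_le_iff by blast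
        then show "real a ^ 2 / 4 \<le> real D" by simp
      qed (use \<kappa> lna in simp)
      finally show ?thesis by (rule mult_left_le_imp_le) (use D in simp)
    qed
    then obtain cH where cH: "proper_edge_coloring (H, [H]\<^bsup>2\<^esup>) cH" "\<forall>K\<subseteq>H. card K = 2 * a \<longrightarrow> \<not> inj_on cH ([K]\<^bsup>2\<^esup>)"
      using col[OF a(1) finH] by blast
    have "2 * D < 2 * a choose 2"
    proof -
      have "(2 * a choose 2) = a * (2 * a - 1)" by (simp add: choose_two)
      moreover have "a * a < a * (2 * a - 1)" using a by simp
      ultimately show ?thesis using D(1) unfolding power2_eq_square by linarith
    qed
    then show False
      using not_forces_if_high_degree_colorable[OF G(1) H_def cH] D(3) a(4) G(2) by simp
  qed
  moreover have "c > 0" using \<kappa> by (simp add: c_def)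
  ultimately show ?thesis by blast
qed

text \<open>Giving all edges different colors is proper, so a forcing graph contains a clique on n
  \<ge> 2 vertices. This covers the n below the asymptotic range.\<close>

lemma forcing_graph_has_edge:
  fixes G :: "nat graph"
  assumes G: "finite_simple_graph G" "forces_rainbow G (complete_graph n)" and n: "n \<ge> 2"
  shows "card (edges G) \<ge> 1"
proof -
  have finE: "finite (edges G)"
    using G(1) finite_imp_finite_nsets finite_subset unfolding finite_simple_graph_def by metis
  from finite_imp_inj_to_nat_seg[OF finE] obtain idx :: "nat set \<Rightarrow> nat"
    where "inj_on idx (edges G)" by (elim exE conjE)
  then have "proper_edge_coloring G idx" by (auto simp: proper_edge_coloring_def inj_on_def)
  then obtain K where K: "finite K" "card K = n" "[K]\<^bsup>2\<^esup> \<subseteq> edges G"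
    using G(2) unfolding forces_rainbow_complete_iff by metis
  have "1 \<le> n choose 2" using n by (simp add: Suc_leI)
  also have "\<dots> = card ([K]\<^bsup>2\<^esup>)" using K by (simp add: card_nsets)
  also have "\<dots> \<le> card (edges G)" using finE K by (intro card_mono)
  finally show ?thesis .
qed

lemma AR_complete_lower:
  "\<exists>c>0. \<forall>n\<ge>2. c * real n ^ 5 / ln (real n) \<le> real (AR\<^sub>s (complete_graph n))"
proof -
  obtain c n\<^sub>0 where c: "c > 0" and large: "\<And>n G. n \<ge> n\<^sub>0 \<Longrightarrow> finite_simple_graph (G :: nat graph) \<Longrightarrow>
    forces_rainbow G (complete_graph n) \<Longrightarrow> c * real n ^ 5 / ln (real n) \<le> real (card (edges G))"
    using edges_of_forcing_graph_large by metis
  \<comment> \<open>The second entry makes the claimed bound at most 1 for n below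
    \<open>n\<^sub>0\<close>, using ln n \<ge> ln 2; the added 1 keeps the denominator positive even
    if \<open>n\<^sub>0\<close> is 0.\<close>
  define c' where "c' = min c (ln 2 / (1 + real n\<^sub>0 ^ 5))"
  have c': "c' > 0" "c' \<le> c" using c by (simp_all add: c'_def add_pos_nonneg)
  have "c' * real n ^ 5 / ln (real n) \<le> real (AR\<^sub>s (complete_graph n))" if n: "n \<ge> 2" for n
  proof -
    obtain s :: nat where "s \<ge> 1584" "48 * real n ^ 3 \<le> real s ^ 35 * ln (real s)"
      using upper_parameter_exists n by metis
    then obtain G\<^sub>1 :: "nat graph" where "finite_simple_graph G\<^sub>1" "forces_rainbow G\<^sub>1 (complete_graph n)"
      using AR_complete_le(2) by blast
    then have "\<exists>m. \<exists>G :: nat graph. finite_simple_graph G \<and> card (edges G) = m \<and> forces_rainbow G (complete_graph n)"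
      by blast
    from LeastI_ex[OF this] obtain G :: "nat graph" where
      G: "finite_simple_graph G" "card (edges G) = AR\<^sub>s (complete_graph n)" "forces_rainbow G (complete_graph n)"
      unfolding AR\<^sub>s_def by blast
    have lnn: "ln (real n) \<ge> ln 2" "ln (real n) > 0" using n by auto
    show ?thesis
    proof (cases "n \<ge> n\<^sub>0")
      case True
      have "c' * real n ^ 5 / ln (real n) \<le> c * real n ^ 5 / ln (real n)"
        using c' lnn by (intro divide_right_mono mult_right_mono) auto
      also have "\<dots> \<le> real (AR\<^sub>s (complete_graph n))" using large[OF True G(1,3)] G(2) by simp
      finally show ?thesis .
    next
      case False
      have "c' * real n ^ 5 \<le> (ln 2 / (1 + real n\<^sub>0 ^ 5)) * (1 + real n\<^sub>0 ^ 5)"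
      proof (rule mult_mono)
        have "real n ^ 5 \<le> real n\<^sub>0 ^ 5" using False by (intro power_mono) auto
        then show "real n ^ 5 \<le> 1 + real n\<^sub>0 ^ 5" by linarith
      qed (auto simp: c'_def)
      also have "\<dots> = ln 2" by (simp add: add_nonneg_eq_0_iff)
      finally have "c' * real n ^ 5 / ln (real n) \<le> 1" using lnn by (simp add: field_simps)
      also have "\<dots> \<le> real (AR\<^sub>s (complete_graph n))"
        using forcing_graph_has_edge[OF G(1,3) n] G(2) by simp
      finally show ?thesis .
    qed
  qed
  then show ?thesis using c'(1) by blast
qed

theorem theorem4:
  shows "\<exists>c\<^sub>1 c\<^sub>2 :: real. c\<^sub>1 > 0 \<and> c\<^sub>2 > 0 \<and>
    (\<forall>n :: nat. n \<ge> 2 \<longrightarrow>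
       c\<^sub>1 * real n ^ 5 / ln (real n) \<le> real (AR\<^sub>s (complete_graph n)) \<and>
       real (AR\<^sub>s (complete_graph n)) \<le> c\<^sub>2 * real n ^ 6 / (ln (real n))\<^sup>2)"
  using AR_complete_lower AR_complete_upper by blast

end
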